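(* Let $N\ge1$ be an integer, $\alpha\in(0,N)$, $p,q\ge1$, and let $\theta_1,\theta_2>1$ be such that $\frac1{\theta_1}+\frac1{\theta_2}=\frac{N+\alpha}{N}$. Suppose that $(u_n)\subset L^{\theta_1p}(\mathbb{R}^N)$ and $(v_n)\subset L^{\theta_2q}(\mathbb{R}^N)$ are bounded sequences such that $u_n\to u$ and $v_n\to v$ almost everywhere in $\mathbb{R}^N$. Then $$\lim_{n\to+\infty}\left[\int_{\mathbb{R}^N}(I_\alpha*|u_n|^p)|v_n|^q\,dx-\int_{\mathbb{R}^N}(I_\alpha*|u_n-u|^p)|v_n-v|^q\,dx\right]=\int_{\mathbb{R}^N}(I_\alpha*|u|^p)|v|^q\,dx.$$
   Context: The Riesz potential is $I_\alpha(x)=\frac{\Gamma((N-\alpha)/2)}{\Gamma(\alpha/2)\pi^{N/2}2^\alpha}|x|^{-(N-\alpha)}$, and $*$ is convolution on $\mathbb{R}^N$. Functions are real-valued. *)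

theory Defs
  imports "HOL-Analysis.Analysis"
begin

text \<open>
  The space \<open>\<real>\<^sup>N\<close> is an arbitrary type \<open>'a\<close> of class \<open>euclidean_space\<close>, with \<open>N = DIM('a) \<ge> 1\<close>.
  Measurability, integrals and "almost everywhere" refer to the (complete) Lebesgue measure.
\<close>

text \<open>Individual functions, not equivalence classes modulo null sets; intended for \<open>r > 0\<close>.\<close>

definition Lp_space :: "real \<Rightarrow> ('a::euclidean_space \<Rightarrow> real) set" where
  "Lp_space r =
     {f \<in> borel_measurable lebesgue. integrable lebesgue (\<lambda>x. \<bar>f x\<bar> powr r)}"

definition Lp_norm :: "real \<Rightarrow> ('a::euclidean_space \<Rightarrow> real) \<Rightarrow> real" where
  "Lp_norm r f = (\<integral>x. \<bar>f x\<bar> powr r \<partial>lebesgue) powr (1 / r)"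

definition convolve ::
    "('a::euclidean_space \<Rightarrow> real) \<Rightarrow> ('a \<Rightarrow> real) \<Rightarrow> 'a \<Rightarrow> real" where
  "convolve f g x = (\<integral>y. f (x - y) * g y \<partial>lebesgue)"

text \<open>At the origin, where the kernel is singular, \<open>powr\<close> gives the value 0; this concerns a null set only.\<close>

definition riesz_potential :: "real \<Rightarrow> 'a::euclidean_space \<Rightarrow> real" where
  "riesz_potential \<alpha> x =
     Gamma ((real DIM('a) - \<alpha>) / 2)
       / (Gamma (\<alpha> / 2) * pi powr (real DIM('a) / 2) * 2 powr \<alpha>)
     * norm x powr (- (real DIM('a) - \<alpha>))"

end

theory Submission
  imports Defs
begin

text \<open>
  Write \<open>B(f, g)\<close> for the double integral of \<open>\<bar>x - y\<bar>\<^bsup>-\<lambda>\<^esup> f(y) g(x)\<close>, where \<open>\<lambda> = N - \<alpha>\<close>, write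
  \<open>\<theta>\<close> and \<open>\<tau>\<close> for \<open>\<theta>\<^sub>1\<close> and \<open>\<theta>\<^sub>2\<close>, and put
  \<open>f\<^sub>n = \<bar>u\<^sub>n\<bar>\<^sup>p\<close>, \<open>g\<^sub>n = \<bar>u\<^sub>n - u\<bar>\<^sup>p\<close>, \<open>F = \<bar>u\<bar>\<^sup>p\<close>, \<open>h\<^sub>n = \<bar>v\<^sub>n\<bar>\<^sup>q\<close>, \<open>k\<^sub>n = \<bar>v\<^sub>n - v\<bar>\<^sup>q\<close>, \<open>H = \<bar>v\<bar>\<^sup>q\<close>.
  Up to the constant of the Riesz potential, the claim is \<open>B(f\<^sub>n, h\<^sub>n) - B(g\<^sub>n, k\<^sub>n) \<longlonglongrightarrow> B(F, H)\<close>.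
  It is a Brezis--Lieb argument carried out directly for the measure
  \<open>\<bar>x - y\<bar>\<^bsup>-\<lambda>\<^esup> dx dy\<close> on the product space. From \<open>\<bar>f\<^sub>n - g\<^sub>n\<bar> \<le> \<epsilon> g\<^sub>n + C F\<close> and
  \<open>\<bar>h\<^sub>n - k\<^sub>n\<bar> \<le> \<epsilon> k\<^sub>n + C H\<close> one gets pointwise (\<open>product_perturb\<close>)

  \<open>\<bar>f\<^sub>n h\<^sub>n - g\<^sub>n k\<^sub>n - F H\<bar> \<le> 3\<epsilon> g\<^sub>n k\<^sub>n + 2C (g\<^sub>n H + F k\<^sub>n) + (C\<^sup>2 + 1) F H.\<close>

  The positive excess of the left side over the first two terms on the right is dominated by a multiple of
  \<open>F H\<close> and tends to zero almost everywhere. So three facts remain: \<open>B(F, H)\<close> is finite,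
  \<open>B(g\<^sub>n, k\<^sub>n)\<close> is bounded, and the mixed terms \<open>B(g\<^sub>n, H)\<close> and \<open>B(F, k\<^sub>n)\<close> tend to zero.

  The first two are the Hardy--Littlewood--Sobolev inequality. It follows from a bound on potentials of
  functions cut off at a height \<open>s\<close> (\<open>capped_potential\<close>): if \<open>\<integral> h\<^sup>\<tau> \<le> A\<close>, then

  \<open>\<integral> \<bar>x - y\<bar>\<^bsup>-\<lambda>\<^esup> h(y) 1{h(y) \<le> s} dy \<le> C s\<^sup>\<gamma>\<close>, uniformly in \<open>x\<close>.

  Near \<open>x\<close> one uses \<open>h \<le> s\<close>, far from \<open>x\<close> one uses Young's inequality, and the radius is chosen to
  balance the two. Splitting the product space according to whether \<open>h(x)\<close> is at most
  \<open>t f(y)\<^bsup>\<theta>/\<tau>\<^esup>\<close> or not, this bound can be applied to \<open>h\<close> on the first region and to \<open>f\<close> on the second;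
  because of \<open>1/\<theta> + 1/\<tau> + \<lambda>/N = 2\<close> the exponents are such that \<open>\<integral> f\<^sup>\<theta>\<close> and \<open>\<integral> h\<^sup>\<tau>\<close> come out.

  The same splitting gives the mixed terms (\<open>riesz_form_tendsto_0\<close>): the second region contributes
  at most a constant times \<open>t\<^bsup>1 - \<tau>\<^esup>\<close>, which is small for large \<open>t\<close>, uniformly in \<open>n\<close>, and on the
  first region dominated convergence applies, since the inner integrals, multiplied by \<open>F(y)\<close>, are at most a
  multiple of the integrable function \<open>F\<^sup>\<theta>\<close>.
\<close>

section \<open>Lebesgue measure on the product space\<close>

text \<open>
  Tonelli's theorem is used on \<open>lebesgue \<Otimes>\<^sub>M lebesgue\<close> itself, so that Lebesgue measurable functions can
  stay as they are and need not be replaced by Borel representatives.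
\<close>

lemma sigma_finite_lebesgue: "sigma_finite_measure (lebesgue :: 'a::euclidean_space measure)"
proof
  obtain A :: "'a set set" where A: "countable A" "A \<subseteq> sets lborel" "\<Union>A = space lborel"
    "\<forall>a\<in>A. emeasure lborel a \<noteq> \<infinity>"
    using lborel.sigma_finite_countable by blast
  then show "\<exists>A::'a set set. countable A \<and> A \<subseteq> sets lebesgue \<and> \<Union>A = space lebesgue
      \<and> (\<forall>a\<in>A. emeasure lebesgue a \<noteq> \<infinity>)"
    by (intro exI[of _ A]) (auto simp: emeasure_completion subset_iff)
qed

interpretation lebesgue: sigma_finite_measure "lebesgue :: 'a::euclidean_space measure"
  by (rule sigma_finite_lebesgue)

interpretation lebesgue_pair: pair_sigma_finite
  "lebesgue :: 'a::euclidean_space measure" "lebesgue :: 'b::euclidean_space measure" ..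

lemma measurable_fst_lebesgue_borel:
  "fst \<in> (lebesgue :: 'a::euclidean_space measure) \<Otimes>\<^sub>M N \<rightarrow>\<^sub>M borel"
  by (rule measurable_compose[OF measurable_fst]) (auto intro: measurable_completion)

lemma measurable_snd_lebesgue_borel:
  "snd \<in> N \<Otimes>\<^sub>M (lebesgue :: 'a::euclidean_space measure) \<rightarrow>\<^sub>M borel"
  by (rule measurable_compose[OF measurable_snd]) (auto intro: measurable_completion)

section \<open>Integrals of the kernel near and far from its pole\<close>

text \<open>
  On each shell \<open>a\<^sub>k \<le> \<bar>x - y\<bar> < b\<^sub>k\<close> the kernel is at most its value at the inner radius, and the shell
  is no larger than the ball of the outer radius; the shells may overlap. With dyadic radii the
  resulting series is geometric, which gives the two power laws below with constants independent of
  the centre, without polar coordinates.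
\<close>

lemma kernel_shells:
  fixes x :: "'a::euclidean_space"
  assumes shells: "\<And>y. y \<in> S \<Longrightarrow> y \<noteq> x \<Longrightarrow> \<exists>k::nat. a k \<le> dist x y \<and> dist x y < b k"
    and pos: "\<And>k. 0 < a k" "\<And>k. 0 < b k" and "0 \<le> \<mu>"
    and S [measurable]: "S \<in> sets lebesgue"
    and sums: "(\<lambda>k. a k powr - \<mu> * b k powr real DIM('a)) sums c"
  shows "(\<integral>\<^sup>+y. ennreal (norm (x - y) powr - \<mu>) * indicator S y \<partial>lebesgue)
           \<le> ennreal (unit_ball_vol (real DIM('a)) * c)"
proof -
  have meas: "(\<lambda>y. ennreal (a k powr - \<mu>) * indicator (ball x (b k)) y) \<in> borel_measurable lebesgue" for k
    by (intro borel_measurable_times_ennreal borel_measurable_indicator borel_measurable_const) simp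
  have "(\<integral>\<^sup>+y. ennreal (norm (x - y) powr - \<mu>) * indicator S y \<partial>lebesgue)
      \<le> (\<integral>\<^sup>+y. (\<Sum>k. ennreal (a k powr - \<mu>) * indicator (ball x (b k)) y) \<partial>lebesgue)"
  proof (rule nn_integral_mono)
    fix y
    show "ennreal (norm (x - y) powr - \<mu>) * indicator S y
        \<le> (\<Sum>k. ennreal (a k powr - \<mu>) * indicator (ball x (b k)) y)"
    proof (cases "y \<in> S \<and> y \<noteq> x")
      case True
      then obtain k where k: "a k \<le> dist x y" "dist x y < b k" using shells by blast
      have "norm (x - y) powr - \<mu> \<le> a k powr - \<mu>"
        using k pos[of k] \<open>0 \<le> \<mu>\<close> by (intro powr_mono2') (auto simp: dist_norm)
      then have "ennreal (norm (x - y) powr - \<mu>) * indicator S y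
          \<le> ennreal (a k powr - \<mu>) * indicator (ball x (b k)) y"
        using True k by (auto simp: ennreal_leI)
      also have "\<dots> = (\<Sum>j\<in>{k}. ennreal (a j powr - \<mu>) * indicator (ball x (b j)) y)"
        by (simp only: sum.insert sum.empty finite.emptyI empty_iff not_False_eq_True add_0_right)
      also have "\<dots> \<le> (\<Sum>k. ennreal (a k powr - \<mu>) * indicator (ball x (b k)) y)"
        by (rule sum_le_suminf) auto
      finally show ?thesis .
    qed auto
  qed
  also have "\<dots> = (\<Sum>k. \<integral>\<^sup>+y. ennreal (a k powr - \<mu>) * indicator (ball x (b k)) y \<partial>lebesgue)"
    by (rule nn_integral_suminf[OF meas])
  also have "\<dots> = (\<Sum>k. ennreal (unit_ball_vol (real DIM('a)) * (a k powr - \<mu> * b k powr real DIM('a))))"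
  proof (rule suminf_cong)
    fix k
    have "(\<integral>\<^sup>+y. ennreal (a k powr - \<mu>) * indicator (ball x (b k)) y \<partial>lebesgue)
        = ennreal (a k powr - \<mu>) * ennreal (unit_ball_vol (real DIM('a)) * b k ^ DIM('a))"
      using pos(2)[of k, THEN less_imp_le] by (subst nn_integral_cmult_indicator) (simp_all add: emeasure_ball)
    also have "b k ^ DIM('a) = b k powr real DIM('a)" using pos[of k] by (simp add: powr_realpow)
    finally show "(\<integral>\<^sup>+y. ennreal (a k powr - \<mu>) * indicator (ball x (b k)) y \<partial>lebesgue)
        = ennreal (unit_ball_vol (real DIM('a)) * (a k powr - \<mu> * b k powr real DIM('a)))"
      by (simp add: ennreal_mult[symmetric] mult_ac)
  qed
  also have "\<dots> = ennreal (unit_ball_vol (real DIM('a)) * c)"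
    using sums_mult[OF sums, of "unit_ball_vol (real DIM('a))"]
    pos(2)[THEN less_imp_le] by (intro suminf_ennreal_eq) simp_all
  finally show ?thesis .
qed

lemma powr_dyadic_product:
  assumes "0 < (R::real)"
  shows "(R * 2 powr i) powr - m * (R * 2 powr j) powr n = R powr (n - m) * 2 powr (n * j - m * i)"
proof -
  have "(R * 2 powr i) powr - m * (R * 2 powr j) powr n
      = (R powr n * R powr - m) * (2 powr (n * j) * 2 powr - (m * i))"
    using assms by (simp add: powr_mult powr_powr mult.commute mult.left_commute)
  then show ?thesis by (simp only: powr_add[symmetric] diff_conv_add_uminus)
qed

text \<open>
Shells of radii \<open>R 2\<^bsup>-(k+1)\<^esup>\<close> and \<open>R 2\<^bsup>-k\<^esup>\<close>; the ratio of the series is below 1 because \<open>\<lambda> < N\<close>.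
\<close>

lemma kernel_near:
  assumes lam: "0 \<le> lam" "lam < real DIM('a)"
  obtains C where "0 \<le> C" "\<And>(x::'a::euclidean_space) R. 0 < R \<Longrightarrow>
    (\<integral>\<^sup>+y. ennreal (norm (x - y) powr - lam) * indicator (ball x R) y \<partial>lebesgue)
      \<le> ennreal (C * R powr (real DIM('a) - lam))"
proof -
  define N where "N = real DIM('a)"
  define q where "q = 2 powr - (N - lam)"
  have q: "0 < q" "q < 1"
    using lam powr_less_mono[of "- (N - lam)" 0 2] by (simp_all add: q_def N_def)
  define C where "C = unit_ball_vol N * (2 powr lam * (1 / (1 - q)))"
  have "0 \<le> C" using q by (auto simp: C_def N_def)
  moreover have "(\<integral>\<^sup>+y. ennreal (norm (x - y) powr - lam) * indicator (ball x R) y \<partial>lebesgue)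
      \<le> ennreal (C * R powr (N - lam))" if R: "0 < R" for x :: 'a and R
  proof -
    define a where "a k = R / 2 ^ Suc k" for k
    define b where "b k = R / 2 ^ k" for k
    have shell: "a k powr - lam * b k powr N = R powr (N - lam) * 2 powr lam * q ^ k" for k
    proof -
      have "q ^ k = q powr real k" using q by (simp add: powr_realpow)
      also have "\<dots> = 2 powr - (real k * (N - lam))"
        by (simp add: q_def powr_powr algebra_simps)
      finally have qk: "q ^ k = 2 powr - (real k * (N - lam))" .
      have ab: "a k = R * 2 powr - (real k + 1)" "b k = R * 2 powr - real k"
        using powr_realpow[of 2 k] powr_realpow[of 2 "Suc k"]
        by (simp_all only: a_def b_def powr_minus_divide of_nat_Suc add.commute) simp_all
      have ex: "N * (- real k) - lam * (- (real k + 1)) = lam + - (real k * (N - lam))"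
        by (simp add: algebra_simps)
      show ?thesis
        unfolding ab powr_dyadic_product[OF R] ex qk by (simp only: powr_add mult.assoc)
    qed
    have "(\<integral>\<^sup>+y. ennreal (norm (x - y) powr - lam) * indicator (ball x R) y \<partial>lebesgue)
        \<le> ennreal (unit_ball_vol (real DIM('a)) * (R powr (N - lam) * 2 powr lam * (1 / (1 - q))))"
    proof (rule kernel_shells[where a = a and b = b])
      show "(\<lambda>k. a k powr - lam * b k powr real DIM('a)) sums (R powr (N - lam) * 2 powr lam * (1 / (1 - q)))"
        unfolding N_def[symmetric] shell using q by (intro sums_mult geometric_sums) auto
      fix y assume y: "y \<in> ball x R" "y \<noteq> x"
      define d where "d = dist x y"
      have d: "0 < d" "d < R" using y by (auto simp: d_def)
      obtain n where "(1/2::real) ^ n < d / R"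
        using real_arch_pow_inv[of "d / R" "1/2"] d R by auto
      then have ex: "R / 2 ^ n < d" using d R by (simp add: field_simps power_divide)
      \<comment> \<open>the first shell whose inner radius is at most the distance; minimality gives the outer bound\<close>
      define k where "k = (LEAST k. a k \<le> d)"
      have "a n = (R / 2 ^ n) / 2" by (simp add: a_def)
      also have "\<dots> \<le> d" using ex d divide_nonneg_nonneg[of R "2 ^ n"] R by simp
      finally have "a n \<le> d" .
      then have k: "a k \<le> d" unfolding k_def by (rule LeastI)
      have "d < b k"
      proof (cases k)
        case 0 then show ?thesis using d by (simp add: b_def)
      next
        case (Suc j)
        then have "\<not> a j \<le> d" using not_less_Least[of j "\<lambda>k. a k \<le> d"] by (simp add: k_def)
        then show ?thesis using Suc by (simp add: a_def b_def)
      qed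
      with k show "\<exists>k. a k \<le> dist x y \<and> dist x y < b k" by (auto simp: d_def)
    qed (use R lam in \<open>auto simp: a_def b_def\<close>)
    then show ?thesis by (simp add: C_def N_def mult_ac)
  qed
  ultimately show thesis unfolding N_def by (rule that)
qed

text \<open>
Shells of radii \<open>R 2\<^bsup>k\<^esup>\<close> and \<open>R 2\<^bsup>k+1\<^esup>\<close>; the ratio of the series is below 1 because \<open>\<mu> > N\<close>.
\<close>

lemma kernel_far:
  assumes mu: "real DIM('a) < \<mu>"
  obtains C where "0 \<le> C" "\<And>(x::'a::euclidean_space) R. 0 < R \<Longrightarrow>
    (\<integral>\<^sup>+y. ennreal (norm (x - y) powr - \<mu>) * indicator (- ball x R) y \<partial>lebesgue)
      \<le> ennreal (C * R powr (real DIM('a) - \<mu>))"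
proof -
  define N where "N = real DIM('a)"
  define q where "q = 2 powr - (\<mu> - N)"
  have q: "0 < q" "q < 1"
    using mu powr_less_mono[of "- (\<mu> - N)" 0 2] by (simp_all add: q_def N_def)
  define C where "C = unit_ball_vol N * (2 powr N * (1 / (1 - q)))"
  have "0 \<le> C" using q by (auto simp: C_def N_def)
  moreover have "(\<integral>\<^sup>+y. ennreal (norm (x - y) powr - \<mu>) * indicator (- ball x R) y \<partial>lebesgue)
      \<le> ennreal (C * R powr (N - \<mu>))" if R: "0 < R" for x :: 'a and R
  proof -
    define a where "a k = R * 2 ^ k" for k
    define b where "b k = R * 2 ^ Suc k" for k
    have shell: "a k powr - \<mu> * b k powr N = R powr (N - \<mu>) * 2 powr N * q ^ k" for k
    proof -
      have "q ^ k = q powr real k" using q by (simp add: powr_realpow)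
      also have "\<dots> = 2 powr - (real k * (\<mu> - N))"
        by (simp add: q_def powr_powr algebra_simps)
      finally have qk: "q ^ k = 2 powr - (real k * (\<mu> - N))" .
      have ab: "a k = R * 2 powr real k" "b k = R * 2 powr (real k + 1)"
        by (auto simp: a_def b_def powr_add powr_realpow)
      have ex: "N * (real k + 1) - \<mu> * (real k) = N + - (real k * (\<mu> - N))"
        by (simp add: algebra_simps)
      show ?thesis
        unfolding ab powr_dyadic_product[OF R] ex qk by (simp only: powr_add mult.assoc)
    qed
    have "(\<integral>\<^sup>+y. ennreal (norm (x - y) powr - \<mu>) * indicator (- ball x R) y \<partial>lebesgue)
        \<le> ennreal (unit_ball_vol (real DIM('a)) * (R powr (N - \<mu>) * 2 powr N * (1 / (1 - q))))"
    proof (rule kernel_shells[where a = a and b = b])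
      show "(\<lambda>k. a k powr - \<mu> * b k powr real DIM('a)) sums (R powr (N - \<mu>) * 2 powr N * (1 / (1 - q)))"
        unfolding N_def[symmetric] shell using q by (intro sums_mult geometric_sums) auto
      fix y assume y: "y \<in> - ball x R" "y \<noteq> x"
      define d where "d = dist x y"
      have d: "R \<le> d" using y by (auto simp: d_def)
      obtain n where n: "d / R < 2 ^ n"
        using real_arch_pow[of 2 "d / R"] by auto
      \<comment> \<open>the first shell whose outer radius exceeds the distance; minimality gives the inner bound\<close>
      define k where "k = (LEAST k. d < b k)"
      have "d < R * 2 ^ n" using n R by (simp add: field_simps)
      also have "\<dots> \<le> b n" using R by (simp add: b_def)
      finally have "d < b n" .
      then have k: "d < b k" unfolding k_def by (rule LeastI)
      have "a k \<le> d"
      proof (cases k)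
        case 0 then show ?thesis using d by (simp add: a_def)
      next
        case (Suc j)
        then have "\<not> d < b j" using not_less_Least[of j "\<lambda>k. d < b k"] by (simp add: k_def)
        then show ?thesis using Suc by (simp add: a_def b_def)
      qed
      with k show "\<exists>k. a k \<le> dist x y \<and> dist x y < b k" by (auto simp: d_def)
    next
      show "0 \<le> \<mu>" using mu of_nat_0_le_iff[of "DIM('a)", where 'a = real] by linarith
    qed (use R in \<open>auto simp: a_def b_def\<close>)
    then show ?thesis by (simp add: C_def N_def mult_ac)
  qed
  ultimately show thesis unfolding N_def by (rule that)
qed

section \<open>Potentials of functions cut off at a fixed height\<close>

text \<open>
  Integrals are shown to vanish in the limit in this form: a part that converges for fixed parameters, and an
  error made small by the choice of a parameter (a radius, a height, or \<open>\<epsilon>\<close>) uniformly in \<open>n\<close>.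
\<close>

lemma ennreal_tendsto_0I:
  assumes "\<And>e::real. 0 < e \<Longrightarrow> \<exists>b. (b \<longlonglongrightarrow> 0) \<and> (\<forall>n. a n \<le> b n + ennreal e)"
  shows "a \<longlonglongrightarrow> (0::ennreal)"
proof (rule order_tendstoI)
  fix c :: ennreal assume "0 < c"
  then obtain d where d: "0 < d" "d < c" using dense by blast
  then obtain r where r: "d = ennreal r" "0 < r"
    by (cases d) (auto simp: ennreal_less_zero_iff)
  obtain b where b: "b \<longlonglongrightarrow> 0" "\<And>n. a n \<le> b n + ennreal (r / 2)"
    using assms[of "r / 2"] r by auto
  have "\<forall>\<^sub>F n in sequentially. b n < ennreal (r / 2)"
    using b(1) r by (intro order_tendstoD(2)) auto
  then show "\<forall>\<^sub>F n in sequentially. a n < c"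
  proof eventually_elim
    case (elim n)
    have "a n \<le> b n + ennreal (r / 2)" by (rule b)
    also have "\<dots> \<le> ennreal (r / 2) + ennreal (r / 2)" using elim by (intro add_mono) auto
    also have "\<dots> = d" using r by (simp add: ennreal_plus[symmetric] del: ennreal_plus)
    finally show ?case using d by simp
  qed
qed auto

lemma kernel_measurable [measurable]:
  "(\<lambda>y::'a::euclidean_space. norm (x - y) powr c) \<in> borel_measurable lebesgue"
  by (rule measurable_completion) measurable

text \<open>
  The hypothesis on \<open>\<lambda>\<close> says that \<open>\<bar>x\<bar>\<^bsup>-\<lambda>\<^esup>\<close> is in \<open>L\<^sup>\<sigma>\<close> away from the origin, where \<open>\<sigma>\<close> is conjugate to
  \<open>\<tau>\<close>. Young's inequality with the weight \<open>w\<close> splits the product; \<open>w\<close> is chosen to give both terms the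
  same power of \<open>R\<close>, the one that Hoelder's inequality would give.
\<close>

lemma far_potential:
  assumes tau: "1 < \<tau>" and lam: "real DIM('a) * (1 - 1 / \<tau>) < lam"
  obtains C where "0 \<le> C" "\<And>(h :: 'a::euclidean_space \<Rightarrow> real) A x R.
    h \<in> borel_measurable lebesgue \<Longrightarrow> (\<And>y. 0 \<le> h y) \<Longrightarrow>
    (\<integral>\<^sup>+y. ennreal (h y powr \<tau>) \<partial>lebesgue) \<le> ennreal A \<Longrightarrow> 0 \<le> A \<Longrightarrow> 0 < R \<Longrightarrow>
    (\<integral>\<^sup>+y. ennreal (norm (x - y) powr - lam * h y) * indicator (- ball x R) y \<partial>lebesgue)
      \<le> ennreal ((A + C) * R powr (real DIM('a) * (1 - 1 / \<tau>) - lam))"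
proof -
  define N where "N = real DIM('a)"
  define \<sigma> where "\<sigma> = \<tau> / (\<tau> - 1)"
  have sigma: "1 < \<sigma>" "1 / \<tau> + 1 / \<sigma> = 1" using tau by (auto simp: \<sigma>_def field_simps)
  define \<beta> where "\<beta> = N * (1 - 1 / \<tau>) - lam"
  have "1 - 1 / \<tau> = 1 / \<sigma>" using sigma(2) by linarith
  then have "N / \<sigma> < lam" using lam by (simp add: N_def)
  then have mu: "N < lam * \<sigma>" using sigma by (simp add: field_simps)
  obtain C where C: "0 \<le> C" "\<And>(x::'a) R. 0 < R \<Longrightarrow>
    (\<integral>\<^sup>+y. ennreal (norm (x - y) powr - (lam * \<sigma>)) * indicator (- ball x R) y \<partial>lebesgue)
      \<le> ennreal (C * R powr (N - lam * \<sigma>))"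
    using kernel_far[where 'a='a, of "lam * \<sigma>"] mu unfolding N_def by blast
  have main: "(\<integral>\<^sup>+y. ennreal (norm (x - y) powr - lam * h y) * indicator (- ball x R) y \<partial>lebesgue)
      \<le> ennreal ((A + C) * R powr \<beta>)"
    if [measurable]: "h \<in> borel_measurable lebesgue" and h0: "\<And>y. 0 \<le> h y"
      and hA: "(\<integral>\<^sup>+y. ennreal (h y powr \<tau>) \<partial>lebesgue) \<le> ennreal A" and A: "0 \<le> A" and R: "0 < R"
    for h :: "'a \<Rightarrow> real" and A x R
  proof -
    \<comment> \<open>the weight for which both terms of Young's inequality scale like \<open>R\<^bsup>\<beta>\<^esup>\<close>\<close>
    define w where "w = R powr (\<beta> / \<tau>)"
    have w: "0 < w" using R by (simp add: w_def)
    have wt: "w powr \<tau> = R powr \<beta>" using tau by (simp add: w_def powr_powr)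
    have exps: "N - lam * \<sigma> - \<beta> / \<tau> * \<sigma> = \<beta>"
    proof -
      have conj: "1 - 1 / \<tau> = 1 / \<sigma>" using sigma(2) by linarith
      have "(1 - 1 / \<tau>) * \<sigma> = 1" unfolding conj using sigma(1) by simp
      moreover have "\<beta> * \<sigma> = N * ((1 - 1 / \<tau>) * \<sigma>) - lam * \<sigma>"
        by (simp add: \<beta>_def algebra_simps)
      ultimately have "\<beta> * \<sigma> = N - lam * \<sigma>" by simp
      moreover have "\<sigma> / \<tau> = \<sigma> - 1" using tau by (simp add: \<sigma>_def field_simps)
      then have "\<beta> / \<tau> * \<sigma> = \<beta> * (\<sigma> - 1)" by (metis times_divide_eq_right times_divide_eq_left)
      ultimately show ?thesis by (simp add: right_diff_distrib)
    qed
    have ws: "R powr (N - lam * \<sigma>) * w powr - \<sigma> = R powr \<beta>"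
      unfolding w_def powr_powr powr_add[symmetric] using exps by simp
    have pw: "norm (x - y) powr - lam * h y
        \<le> R powr \<beta> * h y powr \<tau> + w powr - \<sigma> * norm (x - y) powr - (lam * \<sigma>)" for y
    proof -
      have "norm (x - y) powr - lam * h y = (w * h y) * (norm (x - y) powr - lam / w)"
        using w by simp
      also have "\<dots> \<le> (w * h y) powr \<tau> / \<tau> + (norm (x - y) powr - lam / w) powr \<sigma> / \<sigma>"
        using w h0[of y] tau sigma by (intro Youngs_inequality) auto
      also have "\<dots> \<le> (w * h y) powr \<tau> + (norm (x - y) powr - lam / w) powr \<sigma>"
        using tau sigma by (intro add_mono) (auto simp: divide_le_eq mult_le_cancel_left1)
      also have "(w * h y) powr \<tau> = R powr \<beta> * h y powr \<tau>"
        using w h0[of y] wt by (simp add: powr_mult)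
      also have "(norm (x - y) powr - lam / w) powr \<sigma>
          = w powr - \<sigma> * norm (x - y) powr - (lam * \<sigma>)"
        using w by (simp add: powr_divide powr_mult powr_powr powr_minus_divide)
      finally show ?thesis .
    qed
    have m: "(\<lambda>y. ennreal (norm (x - y) powr - (lam * \<sigma>)) * indicator (- ball x R) y) \<in> borel_measurable lebesgue"
      by (intro borel_measurable_times_ennreal borel_measurable_indicator) auto
    have "(\<integral>\<^sup>+y. ennreal (norm (x - y) powr - lam * h y) * indicator (- ball x R) y \<partial>lebesgue)
        \<le> (\<integral>\<^sup>+y. ennreal (R powr \<beta>) * ennreal (h y powr \<tau>)
            + ennreal (w powr - \<sigma>) * (ennreal (norm (x - y) powr - (lam * \<sigma>)) * indicator (- ball x R) y) \<partial>lebesgue)"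
      using pw by (intro nn_integral_mono)
        (auto simp: indicator_def ennreal_mult[symmetric] ennreal_plus[symmetric] simp del: ennreal_plus intro!: ennreal_leI)
    also have "\<dots> = ennreal (R powr \<beta>) * (\<integral>\<^sup>+y. ennreal (h y powr \<tau>) \<partial>lebesgue)
        + ennreal (w powr - \<sigma>) * (\<integral>\<^sup>+y. ennreal (norm (x - y) powr - (lam * \<sigma>)) * indicator (- ball x R) y \<partial>lebesgue)"
      using m by (subst nn_integral_add) (auto simp: nn_integral_cmult)
    also have "\<dots> \<le> ennreal (R powr \<beta>) * ennreal A + ennreal (w powr - \<sigma>) * ennreal (C * R powr (N - lam * \<sigma>))"
      using hA C(2)[OF R, of x] by (intro add_mono mult_left_mono) auto
    also have "\<dots> = ennreal (R powr \<beta> * A + C * (R powr (N - lam * \<sigma>) * w powr - \<sigma>))"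
      using A C(1) by (simp add: ennreal_mult[symmetric] ennreal_plus[symmetric] mult_ac del: ennreal_plus)
    also have "\<dots> = ennreal ((A + C) * R powr \<beta>)" unfolding ws by (simp add: algebra_simps)
    finally show ?thesis .
  qed
  show thesis using that[OF C(1)] main unfolding \<beta>_def N_def by blast
qed

text \<open>
  The heart of the proof. Inside the ball of radius \<open>R\<close> the cut-off \<open>h \<le> s\<close> gives \<open>s R\<^bsup>N - \<lambda>\<^esup>\<close>, outside it
  \<open>far_potential\<close> gives a negative power of \<open>R\<close>; the two agree for \<open>R = s\<^bsup>-\<tau>/N\<^esup>\<close>. Since the bound does not
  depend on \<open>x\<close>, it serves as a pointwise estimate in the outer variable of a double integral.
\<close>

lemma capped_potential:
  assumes tau: "1 < \<tau>" and lam: "real DIM('a) * (1 - 1 / \<tau>) < lam" "lam < real DIM('a)"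
  obtains C where "0 \<le> C" "\<And>(h :: 'a::euclidean_space \<Rightarrow> real) A x s.
    h \<in> borel_measurable lebesgue \<Longrightarrow> (\<And>y. 0 \<le> h y) \<Longrightarrow>
    (\<integral>\<^sup>+y. ennreal (h y powr \<tau>) \<partial>lebesgue) \<le> ennreal A \<Longrightarrow> 0 \<le> A \<Longrightarrow> 0 \<le> s \<Longrightarrow>
    (\<integral>\<^sup>+y. ennreal (norm (x - y) powr - lam * h y) * indicator {y. h y \<le> s} y \<partial>lebesgue)
      \<le> ennreal (C * (1 + A) * s powr (\<tau> * lam / real DIM('a) - \<tau> + 1))"
proof -
  define N where "N = real DIM('a)"
  have N: "0 < N" by (simp add: N_def)
  have lam0: "0 \<le> lam" using lam(1) tau by (smt (verit) divide_le_eq_1 mult_nonneg_nonneg of_nat_0_le_iff)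
  obtain C1 where C1: "0 \<le> C1" "\<And>(x::'a) R. 0 < R \<Longrightarrow>
    (\<integral>\<^sup>+y. ennreal (norm (x - y) powr - lam) * indicator (ball x R) y \<partial>lebesgue)
      \<le> ennreal (C1 * R powr (N - lam))"
    using kernel_near[where 'a='a, OF lam0 lam(2)] unfolding N_def by blast
  obtain C2 where C2: "0 \<le> C2" "\<And>(h :: 'a \<Rightarrow> real) A x R.
    h \<in> borel_measurable lebesgue \<Longrightarrow> (\<And>y. 0 \<le> h y) \<Longrightarrow>
    (\<integral>\<^sup>+y. ennreal (h y powr \<tau>) \<partial>lebesgue) \<le> ennreal A \<Longrightarrow> 0 \<le> A \<Longrightarrow> 0 < R \<Longrightarrow>
    (\<integral>\<^sup>+y. ennreal (norm (x - y) powr - lam * h y) * indicator (- ball x R) y \<partial>lebesgue)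
      \<le> ennreal ((A + C2) * R powr (N * (1 - 1 / \<tau>) - lam))"
    using far_potential[where 'a='a, OF tau lam(1)] unfolding N_def by blast
  define \<gamma> where "\<gamma> = \<tau> * lam / N - \<tau> + 1"
  have main: "(\<integral>\<^sup>+y. ennreal (norm (x - y) powr - lam * h y) * indicator {y. h y \<le> s} y \<partial>lebesgue)
      \<le> ennreal ((C1 + C2 + 1) * (1 + A) * s powr \<gamma>)"
    if [measurable]: "h \<in> borel_measurable lebesgue" and h0: "\<And>y. 0 \<le> h y"
      and hA: "(\<integral>\<^sup>+y. ennreal (h y powr \<tau>) \<partial>lebesgue) \<le> ennreal A" and A: "0 \<le> A" and s: "0 \<le> s"
    for h :: "'a \<Rightarrow> real" and A x s
  \<comment> \<open>for \<open>s = 0\<close> no finite radius balances the two estimates, but the integrand vanishes\<close>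
  proof (cases "s = 0")
    case True
    have z: "ennreal (norm (x - y) powr - lam * h y) * indicator {y. h y \<le> s} y = 0" for y
      using h0[of y] True by (auto simp: indicator_def)
    show ?thesis unfolding z by simp
  next
    case False
    with s have s: "0 < s" by simp
    \<comment> \<open>the radius at which the near and the far estimate are equal\<close>
    define R where "R = s powr (- \<tau> / N)"
    have R: "0 < R" using s by (simp add: R_def)
    have near: "s * R powr (N - lam) = s powr \<gamma>"
    proof -
      have "s * R powr (N - lam) = s powr (1 + (- \<tau> / N) * (N - lam))"
        unfolding R_def powr_powr powr_add using s by simp
      also have "1 + (- \<tau> / N) * (N - lam) = \<gamma>" using N by (simp add: \<gamma>_def field_simps)
      finally show ?thesis .
    qed
    have far: "R powr (N * (1 - 1 / \<tau>) - lam) = s powr \<gamma>"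
    proof -
      have "(- \<tau> / N) * (N * (1 - 1 / \<tau>) - lam) = \<gamma>" using N tau by (simp add: \<gamma>_def field_simps)
      then show ?thesis unfolding R_def powr_powr by simp
    qed
    have m: "(\<lambda>y. ennreal (norm (x - y) powr - lam) * indicator (ball x R) y) \<in> borel_measurable lebesgue"
      "(\<lambda>y. ennreal (norm (x - y) powr - lam * h y) * indicator (- ball x R) y) \<in> borel_measurable lebesgue"
      by (intro borel_measurable_times_ennreal borel_measurable_indicator; force)+
    have "(\<integral>\<^sup>+y. ennreal (norm (x - y) powr - lam * h y) * indicator {y. h y \<le> s} y \<partial>lebesgue)
        \<le> (\<integral>\<^sup>+y. ennreal s * (ennreal (norm (x - y) powr - lam) * indicator (ball x R) y)
            + ennreal (norm (x - y) powr - lam * h y) * indicator (- ball x R) y \<partial>lebesgue)"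
    proof (intro nn_integral_mono)
      fix y
      have "h y \<le> s \<Longrightarrow> norm (x - y) powr - lam * h y \<le> s * norm (x - y) powr - lam"
        by (simp add: mult.commute mult_right_mono)
      then show "ennreal (norm (x - y) powr - lam * h y) * indicator {y. h y \<le> s} y
        \<le> ennreal s * (ennreal (norm (x - y) powr - lam) * indicator (ball x R) y)
            + ennreal (norm (x - y) powr - lam * h y) * indicator (- ball x R) y"
        using s by (auto simp: indicator_def ennreal_mult[symmetric] intro!: ennreal_leI)
    qed
    also have "\<dots> = ennreal s * (\<integral>\<^sup>+y. ennreal (norm (x - y) powr - lam) * indicator (ball x R) y \<partial>lebesgue)
        + (\<integral>\<^sup>+y. ennreal (norm (x - y) powr - lam * h y) * indicator (- ball x R) y \<partial>lebesgue)"
      using m by (subst nn_integral_add) (auto simp: nn_integral_cmult)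
    also have "\<dots> \<le> ennreal s * ennreal (C1 * R powr (N - lam)) + ennreal ((A + C2) * s powr \<gamma>)"
      using C2(2)[OF _ h0 hA A R, of x] unfolding far
      by (intro add_mono mult_left_mono C1(2) R) auto
    also have "\<dots> = ennreal (C1 * (s * R powr (N - lam)) + (A + C2) * s powr \<gamma>)"
      using A C1(1) C2(1) s by (simp add: ennreal_mult[symmetric] ennreal_plus[symmetric] mult_ac del: ennreal_plus)
    also have "\<dots> \<le> ennreal ((C1 + C2 + 1) * (1 + A) * s powr \<gamma>)"
    proof (rule ennreal_leI)
      have "C1 * s powr \<gamma> + (A + C2) * s powr \<gamma> = (C1 + A + C2) * s powr \<gamma>" by (simp add: algebra_simps)
      also have "\<dots> \<le> (C1 + C2 + 1) * (1 + A) * s powr \<gamma>"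
        using A C1(1) C2(1) by (intro mult_right_mono) (auto simp: algebra_simps)
      finally show "C1 * (s * R powr (N - lam)) + (A + C2) * s powr \<gamma> \<le> (C1 + C2 + 1) * (1 + A) * s powr \<gamma>"
        unfolding near .
    qed
    finally show ?thesis .
  qed
  have "0 \<le> C1 + C2 + 1" using C1(1) C2(1) by simp
  from that[OF this] main show thesis unfolding \<gamma>_def N_def by blast
qed

text \<open>
  Inside a ball, \<open>s\<close> times the kernel is an integrable majorant; the contribution of the complement is
  small, uniformly in \<open>n\<close>, when the ball is large.
\<close>

lemma capped_potential_tendsto_0:
  fixes h :: "nat \<Rightarrow> 'a::euclidean_space \<Rightarrow> real"
  assumes tau: "1 < \<tau>" and lam: "real DIM('a) * (1 - 1 / \<tau>) < lam" "lam < real DIM('a)"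
    and h [measurable]: "\<And>n. h n \<in> borel_measurable lebesgue" and h0: "\<And>n y. 0 \<le> h n y"
    and hA: "\<And>n. (\<integral>\<^sup>+y. ennreal (h n y powr \<tau>) \<partial>lebesgue) \<le> ennreal A" and A: "0 \<le> A"
    and ae: "AE y in lebesgue. (\<lambda>n. h n y) \<longlonglongrightarrow> 0" and s: "0 \<le> s"
  shows "(\<lambda>n. \<integral>\<^sup>+y. ennreal (norm (x - y) powr - lam * h n y) * indicator {y. h n y \<le> s} y \<partial>lebesgue)
           \<longlonglongrightarrow> 0"
proof (rule ennreal_tendsto_0I)
  fix e :: real assume e: "0 < e"
  have lam0: "0 \<le> lam" using lam(1) tau by (smt (verit) divide_le_eq_1 mult_nonneg_nonneg of_nat_0_le_iff)
  define \<beta> where "\<beta> = real DIM('a) * (1 - 1 / \<tau>) - lam"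
  have beta: "\<beta> < 0" using lam by (simp add: \<beta>_def)
  obtain C1 where C1: "0 \<le> C1" "\<And>(x::'a) R. 0 < R \<Longrightarrow>
    (\<integral>\<^sup>+y. ennreal (norm (x - y) powr - lam) * indicator (ball x R) y \<partial>lebesgue)
      \<le> ennreal (C1 * R powr (real DIM('a) - lam))"
    using kernel_near[where 'a='a, OF lam0 lam(2)] by blast
  obtain C2 where C2: "0 \<le> C2" "\<And>(h :: 'a \<Rightarrow> real) A x R.
    h \<in> borel_measurable lebesgue \<Longrightarrow> (\<And>y. 0 \<le> h y) \<Longrightarrow>
    (\<integral>\<^sup>+y. ennreal (h y powr \<tau>) \<partial>lebesgue) \<le> ennreal A \<Longrightarrow> 0 \<le> A \<Longrightarrow> 0 < R \<Longrightarrow>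
    (\<integral>\<^sup>+y. ennreal (norm (x - y) powr - lam * h y) * indicator (- ball x R) y \<partial>lebesgue)
      \<le> ennreal ((A + C2) * R powr \<beta>)"
    using far_potential[where 'a='a, OF tau lam(1)] unfolding \<beta>_def by blast
  obtain R where R: "0 < R" "(A + C2) * R powr \<beta> \<le> e"
  proof
    define R where "R = (e / (A + C2 + 1)) powr (1 / \<beta>)"
    have p: "0 < e / (A + C2 + 1)" using e A C2(1) by simp
    then show "0 < R" using e A C2(1) by (simp add: R_def)
    have "R powr \<beta> = e / (A + C2 + 1)" using p beta e A C2(1) by (auto simp: R_def powr_powr)
    then have "(A + C2) * R powr \<beta> = e - R powr \<beta>" using e A C2(1) by (simp add: field_simps)
    then show "(A + C2) * R powr \<beta> \<le> e" by simp
  qed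
  define b where "b n = (\<integral>\<^sup>+y. ennreal (norm (x - y) powr - lam * h n y) * indicator {y. h n y \<le> s} y
      * indicator (ball x R) y \<partial>lebesgue)" for n
  have S: "{y. h n y \<le> s} \<in> sets lebesgue" for n
  proof -
    have "{y \<in> space lebesgue. h n y \<le> s} \<in> sets lebesgue" by measurable
    then show ?thesis by simp
  qed
  have m: "(\<lambda>y. ennreal (norm (x - y) powr - lam * h n y) * indicator {y. h n y \<le> s} y
      * indicator (ball x R) y) \<in> borel_measurable lebesgue"
    "(\<lambda>y. ennreal (norm (x - y) powr - lam) * indicator (ball x R) y) \<in> borel_measurable lebesgue"
    "(\<lambda>y. ennreal (norm (x - y) powr - lam * h n y) * indicator (- ball x R) y) \<in> borel_measurable lebesgue"
    for n
    by (intro borel_measurable_times_ennreal borel_measurable_indicator S; force)+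
  have "b \<longlonglongrightarrow> (\<integral>\<^sup>+y. 0 \<partial>(lebesgue :: 'a measure))"
    unfolding b_def
  proof (rule nn_integral_dominated_convergence)
    show "(\<lambda>y. ennreal s * (ennreal (norm (x - y) powr - lam) * indicator (ball x R) y))
        \<in> borel_measurable lebesgue"
      by (intro borel_measurable_times_ennreal borel_measurable_const m(2))
    have "norm (x - y) powr - lam * h n y \<le> s * norm (x - y) powr - lam" if "h n y \<le> s" for n y
      using that by (simp add: mult.commute mult_right_mono)
    then show "AE y in lebesgue. ennreal (norm (x - y) powr - lam * h j y) * indicator {y. h j y \<le> s} y
        * indicator (ball x R) y \<le> ennreal s * (ennreal (norm (x - y) powr - lam) * indicator (ball x R) y)" for j
      using s by (auto simp: indicator_def ennreal_mult[symmetric] intro!: ennreal_leI)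
    have "(\<integral>\<^sup>+y. ennreal s * (ennreal (norm (x - y) powr - lam) * indicator (ball x R) y) \<partial>lebesgue)
        = ennreal s * (\<integral>\<^sup>+y. ennreal (norm (x - y) powr - lam) * indicator (ball x R) y \<partial>lebesgue)"
      by (rule nn_integral_cmult[OF m(2)])
    also have "\<dots> \<le> ennreal s * ennreal (C1 * R powr (real DIM('a) - lam))"
      by (intro mult_left_mono C1(2) R) auto
    also have "\<dots> < \<infinity>" by (simp add: ennreal_mult_less_top)
    finally show "(\<integral>\<^sup>+y. ennreal s * (ennreal (norm (x - y) powr - lam) * indicator (ball x R) y) \<partial>lebesgue) < \<infinity>" .
    show "AE y in lebesgue. (\<lambda>n. ennreal (norm (x - y) powr - lam * h n y) * indicator {y. h n y \<le> s} y
        * indicator (ball x R) y) \<longlonglongrightarrow> 0"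
      using ae
    proof eventually_elim
      case (elim y)
      have "(\<lambda>n. ennreal (norm (x - y) powr - lam * h n y)) \<longlonglongrightarrow> ennreal (norm (x - y) powr - lam * 0)"
        by (intro tendsto_ennrealI tendsto_intros elim)
      then have lim: "(\<lambda>n. ennreal (norm (x - y) powr - lam * h n y)) \<longlonglongrightarrow> 0" by simp
      show ?case by (rule tendsto_sandwich[OF _ _ tendsto_const lim]) (auto simp: indicator_def)
    qed
  qed (use m in simp_all)
  then have "b \<longlonglongrightarrow> 0" by simp
  moreover have "(\<integral>\<^sup>+y. ennreal (norm (x - y) powr - lam * h n y) * indicator {y. h n y \<le> s} y \<partial>lebesgue)
      \<le> b n + ennreal e" for n
  proof -
    have "(\<integral>\<^sup>+y. ennreal (norm (x - y) powr - lam * h n y) * indicator {y. h n y \<le> s} y \<partial>lebesgue)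
       \<le> (\<integral>\<^sup>+y. ennreal (norm (x - y) powr - lam * h n y) * indicator {y. h n y \<le> s} y * indicator (ball x R) y
          + ennreal (norm (x - y) powr - lam * h n y) * indicator (- ball x R) y \<partial>lebesgue)"
      by (intro nn_integral_mono) (auto simp: indicator_def)
    also have "\<dots> = b n + (\<integral>\<^sup>+y. ennreal (norm (x - y) powr - lam * h n y) * indicator (- ball x R) y \<partial>lebesgue)"
      unfolding b_def by (rule nn_integral_add[OF m(1) m(3)])
    also have "\<dots> \<le> b n + ennreal ((A + C2) * R powr \<beta>)"
      by (intro add_left_mono C2(2) h h0 hA A R)
    also have "\<dots> \<le> b n + ennreal e" using R by (intro add_left_mono ennreal_leI)
    finally show ?thesis .
  qed
  ultimately show "\<exists>b. (b \<longlonglongrightarrow> 0) \<and> (\<forall>n. (\<integral>\<^sup>+y. ennreal (norm (x - y) powr - lam * h n y)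
      * indicator {y. h n y \<le> s} y \<partial>lebesgue) \<le> b n + ennreal e)"
    by blast
qed

section \<open>The Hardy--Littlewood--Sobolev inequality\<close>

text \<open>
  The second component of the pair is the variable of integration of the convolution, so \<open>f\<close> is
  the function that is convolved with the kernel. The normalising constant of the Riesz potential is
  left out, and the value is an extended real, so that finiteness is a statement to be proved.
\<close>

definition riesz_form :: "real \<Rightarrow> ('a::euclidean_space \<Rightarrow> real) \<Rightarrow> ('a \<Rightarrow> real) \<Rightarrow> ennreal" where
  "riesz_form lam f g =
     (\<integral>\<^sup>+z. ennreal (norm (fst z - snd z) powr - lam * f (snd z) * g (fst z)) \<partial>(lebesgue \<Otimes>\<^sub>M lebesgue))"

lemma kernel_pair_measurable [measurable]:
  "(\<lambda>z. norm (fst z - snd z) powr c)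
     \<in> borel_measurable ((lebesgue :: 'a::euclidean_space measure) \<Otimes>\<^sub>M lebesgue)"
proof -
  note measurable_fst_lebesgue_borel [measurable] measurable_snd_lebesgue_borel [measurable]
  show ?thesis by measurable
qed

lemma riesz_form_commute:
  assumes [measurable]: "f \<in> borel_measurable lebesgue" "g \<in> borel_measurable lebesgue"
  shows "riesz_form lam f g = riesz_form lam g f"
proof -
  have "riesz_form lam f g
      = (\<integral>\<^sup>+x. \<integral>\<^sup>+y. ennreal (norm (x - y) powr - lam * f y * g x) \<partial>lebesgue \<partial>lebesgue)"
    unfolding riesz_form_def by (subst lebesgue.nn_integral_fst[symmetric]) auto
  also have "\<dots> = (\<integral>\<^sup>+x. \<integral>\<^sup>+y. ennreal (norm (y - x) powr - lam * g x * f y) \<partial>lebesgue \<partial>lebesgue)"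
    by (intro nn_integral_cong) (simp add: norm_minus_commute mult_ac)
  also have "\<dots> = riesz_form lam g f"
    unfolding riesz_form_def by (subst lebesgue_pair.nn_integral_snd[symmetric]) auto
  finally show ?thesis .
qed

text \<open>
The scaling relation forces the integrability of the kernel at infinity that \<open>far_potential\<close> needs.
\<close>

lemma conjugate_exponent_bound:
  fixes N :: real
  assumes "0 < N" "1 < \<theta>" "1 / \<theta> + 1 / \<tau> + lam / N = 2"
  shows "N * (1 - 1 / \<tau>) < lam"
proof -
  have "1 / \<theta> < 1" using assms by simp
  then have "1 - 1 / \<tau> < lam / N" using assms(3) by linarith
  then show ?thesis using assms(1) by (simp add: field_simps)
qed

text \<open>
  A fibre of the double integral over the region \<open>h(y) \<le> t a\<^bsup>\<theta>/\<tau>\<^esup>\<close>, where \<open>a\<close> is the value of the other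
  function. By the scaling relation the cut-off height enters \<open>capped_potential\<close> with the exponent
  \<open>\<tau> - \<tau>/\<theta>\<close>, hence \<open>a\<close> with the exponent \<open>\<theta> - 1\<close>; the extra factor \<open>a\<close> makes it \<open>a\<^bsup>\<theta>\<^esup>\<close>.
\<close>

lemma capped_fibre:
  assumes exps: "1 < \<theta>" "1 < \<tau>" "lam < real DIM('a)" "1 / \<theta> + 1 / \<tau> + lam / real DIM('a) = 2"
  obtains C where "0 \<le> C" "\<And>(h :: 'a::euclidean_space \<Rightarrow> real) A x t a.
    h \<in> borel_measurable lebesgue \<Longrightarrow> (\<And>y. 0 \<le> h y) \<Longrightarrow>
    (\<integral>\<^sup>+y. ennreal (h y powr \<tau>) \<partial>lebesgue) \<le> ennreal A \<Longrightarrow> 0 \<le> A \<Longrightarrow> 0 \<le> t \<Longrightarrow> 0 \<le> a \<Longrightarrow>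
    (\<integral>\<^sup>+y. ennreal (norm (x - y) powr - lam * h y * a) * indicator {y. h y \<le> t * a powr (\<theta> / \<tau>)} y \<partial>lebesgue)
      \<le> ennreal (C * (1 + A) * t powr (\<tau> - \<tau> / \<theta>) * a powr \<theta>)"
proof -
  have lam: "real DIM('a) * (1 - 1 / \<tau>) < lam"
    by (rule conjugate_exponent_bound[OF _ exps(1,4)]) simp
  have lamN: "lam / real DIM('a) = 2 - 1 / \<theta> - 1 / \<tau>" using exps(4) by linarith
  have "\<tau> * lam / real DIM('a) - \<tau> + 1 = \<tau> * (lam / real DIM('a)) - \<tau> + 1" by simp
  also have "\<dots> = \<tau> - \<tau> / \<theta>"
    unfolding lamN using exps(2) by (simp add: right_diff_distrib)
  finally have e: "\<tau> * lam / real DIM('a) - \<tau> + 1 = \<tau> - \<tau> / \<theta>" .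
  obtain C where C: "0 \<le> C" "\<And>(h :: 'a::euclidean_space \<Rightarrow> real) A x s.
    h \<in> borel_measurable lebesgue \<Longrightarrow> (\<And>y. 0 \<le> h y) \<Longrightarrow>
    (\<integral>\<^sup>+y. ennreal (h y powr \<tau>) \<partial>lebesgue) \<le> ennreal A \<Longrightarrow> 0 \<le> A \<Longrightarrow> 0 \<le> s \<Longrightarrow>
    (\<integral>\<^sup>+y. ennreal (norm (x - y) powr - lam * h y) * indicator {y. h y \<le> s} y \<partial>lebesgue)
      \<le> ennreal (C * (1 + A) * s powr (\<tau> - \<tau> / \<theta>))"
    using capped_potential[where 'a='a, OF exps(2) lam exps(3)] unfolding e by blast
  have main: "(\<integral>\<^sup>+y. ennreal (norm (x - y) powr - lam * h y * a) * indicator {y. h y \<le> t * a powr (\<theta> / \<tau>)} y \<partial>lebesgue)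
      \<le> ennreal (C * (1 + A) * t powr (\<tau> - \<tau> / \<theta>) * a powr \<theta>)"
    if [measurable]: "h \<in> borel_measurable lebesgue" and h0: "\<And>y. 0 \<le> h y"
      and hA: "(\<integral>\<^sup>+y. ennreal (h y powr \<tau>) \<partial>lebesgue) \<le> ennreal A" and A: "0 \<le> A"
      and t: "0 \<le> t" and a: "0 \<le> a"
    for h :: "'a \<Rightarrow> real" and A x t a
  proof -
    let ?s = "t * a powr (\<theta> / \<tau>)"
    have "(\<integral>\<^sup>+y. ennreal (norm (x - y) powr - lam * h y * a) * indicator {y. h y \<le> ?s} y \<partial>lebesgue)
        = (\<integral>\<^sup>+y. ennreal a * (ennreal (norm (x - y) powr - lam * h y) * indicator {y. h y \<le> ?s} y) \<partial>lebesgue)"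
      using a h0 by (intro nn_integral_cong) (auto simp: indicator_def ennreal_mult[symmetric] mult_ac)
    also have "\<dots> = ennreal a * (\<integral>\<^sup>+y. ennreal (norm (x - y) powr - lam * h y) * indicator {y. h y \<le> ?s} y \<partial>lebesgue)"
      by (rule nn_integral_cmult) measurable
    also have "\<dots> \<le> ennreal a * ennreal (C * (1 + A) * ?s powr (\<tau> - \<tau> / \<theta>))"
      using t a by (intro mult_left_mono C(2) h0 hA A that(1)) auto
    also have "\<dots> = ennreal (C * (1 + A) * (?s powr (\<tau> - \<tau> / \<theta>) * a))"
      using a C(1) A by (simp add: ennreal_mult[symmetric] mult_ac)
    also have "?s powr (\<tau> - \<tau> / \<theta>) * a = t powr (\<tau> - \<tau> / \<theta>) * a powr \<theta>"
    proof (cases "a = 0")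
      case True then show ?thesis by simp
    next
      case False
      with a have a: "0 < a" by simp
      have "\<theta> / \<tau> * (\<tau> - \<tau> / \<theta>) = \<theta> - 1" using exps by (simp add: field_simps)
      then have "?s powr (\<tau> - \<tau> / \<theta>) * a = t powr (\<tau> - \<tau> / \<theta>) * (a powr (\<theta> - 1) * a)"
        using a t by (simp add: powr_mult powr_powr)
      also have "a powr (\<theta> - 1) * a = a powr \<theta>" using a by (simp add: powr_diff)
      finally show ?thesis .
    qed
    finally show ?thesis by (simp add: mult.assoc)
  qed
  show thesis using that[OF C(1)] main by blast
qed

text \<open>
  On the complement of the region \<open>h(x) \<le> t f(y)\<^bsup>\<theta>/\<tau>\<^esup>\<close> it is \<open>f(y)\<close> that is cut off, at the height
  \<open>(h(x)/t)\<^bsup>\<tau>/\<theta>\<^esup>\<close>. So \<open>capped_fibre\<close> applies with the two functions exchanged, and bounds that part by a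
  negative power of \<open>t\<close>. The first part is kept as an integral, since it is estimated for
  \<open>t = 1\<close> in the Hardy--Littlewood--Sobolev inequality but needs a limit for large \<open>t\<close> later.
\<close>

lemma riesz_form_split:
  assumes exps: "1 < \<theta>" "1 < \<tau>" "lam < real DIM('a)" "1 / \<theta> + 1 / \<tau> + lam / real DIM('a) = 2"
  obtains C where "0 \<le> C" "\<And>(f :: 'a::euclidean_space \<Rightarrow> real) h A t.
    f \<in> borel_measurable lebesgue \<Longrightarrow> (\<And>y. 0 \<le> f y) \<Longrightarrow>
    h \<in> borel_measurable lebesgue \<Longrightarrow> (\<And>y. 0 \<le> h y) \<Longrightarrow>
    (\<integral>\<^sup>+y. ennreal (f y powr \<theta>) \<partial>lebesgue) \<le> ennreal A \<Longrightarrow>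
    (\<integral>\<^sup>+y. ennreal (h y powr \<tau>) \<partial>lebesgue) \<le> ennreal A \<Longrightarrow> 0 \<le> A \<Longrightarrow> 0 < t \<Longrightarrow>
    riesz_form lam f h \<le>
      (\<integral>\<^sup>+y. \<integral>\<^sup>+x. ennreal (norm (y - x) powr - lam * h x * f y)
          * indicator {x. h x \<le> t * f y powr (\<theta> / \<tau>)} x \<partial>lebesgue \<partial>lebesgue)
      + ennreal (C * (1 + A) * A * t powr (1 - \<tau>))"
proof -
  have exps': "1 / \<tau> + 1 / \<theta> + lam / real DIM('a) = 2" using exps by simp
  obtain C where C: "0 \<le> C" "\<And>(h :: 'a::euclidean_space \<Rightarrow> real) A x t a.
    h \<in> borel_measurable lebesgue \<Longrightarrow> (\<And>y. 0 \<le> h y) \<Longrightarrow>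
    (\<integral>\<^sup>+y. ennreal (h y powr \<theta>) \<partial>lebesgue) \<le> ennreal A \<Longrightarrow> 0 \<le> A \<Longrightarrow> 0 \<le> t \<Longrightarrow> 0 \<le> a \<Longrightarrow>
    (\<integral>\<^sup>+y. ennreal (norm (x - y) powr - lam * h y * a) * indicator {y. h y \<le> t * a powr (\<tau> / \<theta>)} y \<partial>lebesgue)
      \<le> ennreal (C * (1 + A) * t powr (\<theta> - \<theta> / \<tau>) * a powr \<tau>)"
    using capped_fibre[where 'a='a, OF exps(2,1,3) exps'] by blast
  have main: "riesz_form lam f h \<le>
      (\<integral>\<^sup>+y. \<integral>\<^sup>+x. ennreal (norm (y - x) powr - lam * h x * f y)
          * indicator {x. h x \<le> t * f y powr (\<theta> / \<tau>)} x \<partial>lebesgue \<partial>lebesgue)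
      + ennreal (C * (1 + A) * A * t powr (1 - \<tau>))"
    if f [measurable]: "f \<in> borel_measurable lebesgue" and f0: "\<And>y. 0 \<le> f y"
      and h [measurable]: "h \<in> borel_measurable lebesgue" and h0: "\<And>y. 0 \<le> h y"
      and fA: "(\<integral>\<^sup>+y. ennreal (f y powr \<theta>) \<partial>lebesgue) \<le> ennreal A"
      and hA: "(\<integral>\<^sup>+y. ennreal (h y powr \<tau>) \<partial>lebesgue) \<le> ennreal A" and A: "0 \<le> A" and t: "0 < t"
    for f h :: "'a \<Rightarrow> real" and A t
  proof -
    define F where "F z = ennreal (norm (fst z - snd z) powr - lam * f (snd z) * h (fst z))" for z
    define L where "L = {z. h (fst z) \<le> t * f (snd z) powr (\<theta> / \<tau>)}"
    define u where "u = t powr (- \<tau> / \<theta>)"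
    have F [measurable]: "F \<in> borel_measurable (lebesgue \<Otimes>\<^sub>M lebesgue)" unfolding F_def by measurable
    have L: "{z \<in> space (lebesgue \<Otimes>\<^sub>M lebesgue). h (fst z) \<le> t * f (snd z) powr (\<theta> / \<tau>)} \<in> sets (lebesgue \<Otimes>\<^sub>M lebesgue)"
      by measurable
    then have L [measurable]: "L \<in> sets (lebesgue \<Otimes>\<^sub>M lebesgue)" by (simp add: L_def space_pair_measure)
    have high: "f y \<le> u * h x powr (\<tau> / \<theta>)" if "(x, y) \<notin> L" for x y
    proof -
      have "f y powr (\<theta> / \<tau>) \<le> h x / t" using that t by (simp add: L_def field_simps)
      then have "(f y powr (\<theta> / \<tau>)) powr (\<tau> / \<theta>) \<le> (h x / t) powr (\<tau> / \<theta>)"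
        using exps by (intro powr_mono2) auto
      also have "\<dots> = u * h x powr (\<tau> / \<theta>)"
        using t h0[of x] by (simp add: u_def powr_divide powr_minus_divide)
      also have "(f y powr (\<theta> / \<tau>)) powr (\<tau> / \<theta>) = f y" using f0[of y] exps by (simp add: powr_powr)
      finally show ?thesis .
    qed
    have "- \<tau> / \<theta> * (\<theta> - \<theta> / \<tau>) = 1 - \<tau>" using exps by (simp add: field_simps)
    then have ut: "u powr (\<theta> - \<theta> / \<tau>) = t powr (1 - \<tau>)" by (simp add: u_def powr_powr)
    have "riesz_form lam f h = (\<integral>\<^sup>+z. F z * indicator L z + F z * indicator (- L) z \<partial>(lebesgue \<Otimes>\<^sub>M lebesgue))"
      unfolding riesz_form_def F_def[symmetric] by (intro nn_integral_cong) (auto simp: indicator_def)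
    also have "\<dots> = (\<integral>\<^sup>+z. F z * indicator L z \<partial>(lebesgue \<Otimes>\<^sub>M lebesgue))
        + (\<integral>\<^sup>+z. F z * indicator (- L) z \<partial>(lebesgue \<Otimes>\<^sub>M lebesgue))"
      using L by (intro nn_integral_add) (auto simp: Compl_eq_Diff_UNIV space_pair_measure intro!: borel_measurable_times_ennreal borel_measurable_indicator sets.Diff)
    also have "(\<integral>\<^sup>+z. F z * indicator L z \<partial>(lebesgue \<Otimes>\<^sub>M lebesgue))
        = (\<integral>\<^sup>+y. \<integral>\<^sup>+x. ennreal (norm (y - x) powr - lam * h x * f y)
          * indicator {x. h x \<le> t * f y powr (\<theta> / \<tau>)} x \<partial>lebesgue \<partial>lebesgue)"
      by (subst lebesgue_pair.nn_integral_snd[symmetric])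
        (auto simp: F_def L_def indicator_def norm_minus_commute mult_ac intro!: nn_integral_cong)
    also have "(\<integral>\<^sup>+z. F z * indicator (- L) z \<partial>(lebesgue \<Otimes>\<^sub>M lebesgue))
        = (\<integral>\<^sup>+x. \<integral>\<^sup>+y. F (x, y) * indicator (- L) (x, y) \<partial>lebesgue \<partial>lebesgue)"
      using L by (intro lebesgue.nn_integral_fst[symmetric]) (auto simp: Compl_eq_Diff_UNIV space_pair_measure intro!: borel_measurable_times_ennreal borel_measurable_indicator sets.Diff)
    also have "\<dots> \<le> (\<integral>\<^sup>+x. ennreal (C * (1 + A) * t powr (1 - \<tau>)) * ennreal (h x powr \<tau>) \<partial>lebesgue)"
    proof (rule nn_integral_mono)
      fix x
      have "(\<integral>\<^sup>+y. F (x, y) * indicator (- L) (x, y) \<partial>lebesgue)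
          \<le> (\<integral>\<^sup>+y. ennreal (norm (x - y) powr - lam * f y * h x) * indicator {y. f y \<le> u * h x powr (\<tau> / \<theta>)} y \<partial>lebesgue)"
        using high[of x] by (intro nn_integral_mono) (auto simp: F_def indicator_def)
      also have "\<dots> \<le> ennreal (C * (1 + A) * u powr (\<theta> - \<theta> / \<tau>) * h x powr \<tau>)"
        by (intro C(2) f f0 fA A h0) (simp add: u_def)
      finally show "(\<integral>\<^sup>+y. F (x, y) * indicator (- L) (x, y) \<partial>lebesgue)
          \<le> ennreal (C * (1 + A) * t powr (1 - \<tau>)) * ennreal (h x powr \<tau>)"
        unfolding ut using C(1) A by (simp add: ennreal_mult)
    qed
    also have "\<dots> = ennreal (C * (1 + A) * t powr (1 - \<tau>)) * (\<integral>\<^sup>+x. ennreal (h x powr \<tau>) \<partial>lebesgue)"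
      by (rule nn_integral_cmult) measurable
    also have "\<dots> \<le> ennreal (C * (1 + A) * t powr (1 - \<tau>)) * ennreal A"
      by (intro mult_left_mono hA) simp
    also have "\<dots> = ennreal (C * (1 + A) * A * t powr (1 - \<tau>))"
      using C(1) A by (simp add: ennreal_mult[symmetric] mult_ac)
    finally show ?thesis by (simp add: add_left_mono)
  qed
  show thesis using that[OF C(1)] main by blast
qed

text \<open>
  With \<open>t = 1\<close>, both regions are controlled by \<open>capped_fibre\<close>. A bound on bounded sets is
  equivalent to the usual one with norms, by homogeneity, and it is the form in which the inequality is
  applied to bounded sequences.
\<close>

lemma hardy_littlewood_sobolev:
  assumes exps: "1 < \<theta>" "1 < \<tau>" "lam < real DIM('a)" "1 / \<theta> + 1 / \<tau> + lam / real DIM('a) = 2"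
    and A: "0 \<le> A"
  obtains C where "0 \<le> C" "\<And>(f :: 'a::euclidean_space \<Rightarrow> real) h.
    f \<in> borel_measurable lebesgue \<Longrightarrow> (\<And>y. 0 \<le> f y) \<Longrightarrow>
    h \<in> borel_measurable lebesgue \<Longrightarrow> (\<And>y. 0 \<le> h y) \<Longrightarrow>
    (\<integral>\<^sup>+y. ennreal (f y powr \<theta>) \<partial>lebesgue) \<le> ennreal A \<Longrightarrow>
    (\<integral>\<^sup>+y. ennreal (h y powr \<tau>) \<partial>lebesgue) \<le> ennreal A \<Longrightarrow>
    riesz_form lam f h \<le> ennreal C"
proof -
  obtain C1 where C1: "0 \<le> C1" "\<And>(h :: 'a::euclidean_space \<Rightarrow> real) A x t a.
    h \<in> borel_measurable lebesgue \<Longrightarrow> (\<And>y. 0 \<le> h y) \<Longrightarrow>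
    (\<integral>\<^sup>+y. ennreal (h y powr \<tau>) \<partial>lebesgue) \<le> ennreal A \<Longrightarrow> 0 \<le> A \<Longrightarrow> 0 \<le> t \<Longrightarrow> 0 \<le> a \<Longrightarrow>
    (\<integral>\<^sup>+y. ennreal (norm (x - y) powr - lam * h y * a) * indicator {y. h y \<le> t * a powr (\<theta> / \<tau>)} y \<partial>lebesgue)
      \<le> ennreal (C1 * (1 + A) * t powr (\<tau> - \<tau> / \<theta>) * a powr \<theta>)"
    using capped_fibre[where 'a='a, OF exps] by blast
  obtain C2 where C2: "0 \<le> C2" "\<And>(f :: 'a::euclidean_space \<Rightarrow> real) h A t.
    f \<in> borel_measurable lebesgue \<Longrightarrow> (\<And>y. 0 \<le> f y) \<Longrightarrow>
    h \<in> borel_measurable lebesgue \<Longrightarrow> (\<And>y. 0 \<le> h y) \<Longrightarrow>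
    (\<integral>\<^sup>+y. ennreal (f y powr \<theta>) \<partial>lebesgue) \<le> ennreal A \<Longrightarrow>
    (\<integral>\<^sup>+y. ennreal (h y powr \<tau>) \<partial>lebesgue) \<le> ennreal A \<Longrightarrow> 0 \<le> A \<Longrightarrow> 0 < t \<Longrightarrow>
    riesz_form lam f h \<le>
      (\<integral>\<^sup>+y. \<integral>\<^sup>+x. ennreal (norm (y - x) powr - lam * h x * f y)
          * indicator {x. h x \<le> t * f y powr (\<theta> / \<tau>)} x \<partial>lebesgue \<partial>lebesgue)
      + ennreal (C2 * (1 + A) * A * t powr (1 - \<tau>))"
    using riesz_form_split[where 'a='a, OF exps] by blast
  have main: "riesz_form lam f h \<le> ennreal (C1 * (1 + A) * A + C2 * (1 + A) * A)"
    if f [measurable]: "f \<in> borel_measurable lebesgue" and f0: "\<And>y. 0 \<le> f y"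
      and h [measurable]: "h \<in> borel_measurable lebesgue" and h0: "\<And>y. 0 \<le> h y"
      and fA: "(\<integral>\<^sup>+y. ennreal (f y powr \<theta>) \<partial>lebesgue) \<le> ennreal A"
      and hA: "(\<integral>\<^sup>+y. ennreal (h y powr \<tau>) \<partial>lebesgue) \<le> ennreal A"
    for f h :: "'a \<Rightarrow> real"
  proof -
    have "riesz_form lam f h \<le>
      (\<integral>\<^sup>+y. \<integral>\<^sup>+x. ennreal (norm (y - x) powr - lam * h x * f y)
          * indicator {x. h x \<le> 1 * f y powr (\<theta> / \<tau>)} x \<partial>lebesgue \<partial>lebesgue)
      + ennreal (C2 * (1 + A) * A * 1 powr (1 - \<tau>))"
      by (intro C2(2) that A) simp
    also have "\<dots> \<le> (\<integral>\<^sup>+y. ennreal (C1 * (1 + A) * 1 powr (\<tau> - \<tau> / \<theta>) * f y powr \<theta>) \<partial>lebesgue)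
        + ennreal (C2 * (1 + A) * A * 1 powr (1 - \<tau>))"
      by (intro add_right_mono nn_integral_mono C1(2) h h0 hA A f0) simp
    also have "(\<integral>\<^sup>+y. ennreal (C1 * (1 + A) * 1 powr (\<tau> - \<tau> / \<theta>) * f y powr \<theta>) \<partial>lebesgue)
        = ennreal (C1 * (1 + A)) * (\<integral>\<^sup>+y. ennreal (f y powr \<theta>) \<partial>lebesgue)"
      using C1(1) A by (subst nn_integral_cmult[symmetric]) (auto simp: ennreal_mult)
    also have "\<dots> \<le> ennreal (C1 * (1 + A)) * ennreal A" by (intro mult_left_mono fA) simp
    finally show ?thesis
      using C1(1) C2(1) A
      by (simp add: add_right_mono ennreal_mult[symmetric] ennreal_plus[symmetric] del: ennreal_plus)
  qed
  show thesis using that[of "C1 * (1 + A) * A + C2 * (1 + A) * A"] C1(1) C2(1) A main by auto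
qed

text \<open>
  This replaces the usual argument that \<open>h\<^sub>n\<close> converges weakly to zero in \<open>L\<^sup>\<tau>\<close> while the potential of \<open>f\<close>
  lies in the dual space. For large \<open>t\<close> the second region of \<open>riesz_form_split\<close> is negligible. On the first,
  the inner integrals tend to zero by \<open>capped_potential_tendsto_0\<close> and are dominated
  by a multiple of \<open>f\<^sup>\<theta>\<close> by \<open>capped_fibre\<close>.
\<close>

lemma riesz_form_tendsto_0:
  fixes f :: "'a::euclidean_space \<Rightarrow> real" and h :: "nat \<Rightarrow> 'a \<Rightarrow> real"
  assumes exps: "1 < \<theta>" "1 < \<tau>" "lam < real DIM('a)" "1 / \<theta> + 1 / \<tau> + lam / real DIM('a) = 2"
    and A: "0 \<le> A"
    and f [measurable]: "f \<in> borel_measurable lebesgue" and f0: "\<And>y. 0 \<le> f y"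
    and h [measurable]: "\<And>n. h n \<in> borel_measurable lebesgue" and h0: "\<And>n y. 0 \<le> h n y"
    and fA: "(\<integral>\<^sup>+y. ennreal (f y powr \<theta>) \<partial>lebesgue) \<le> ennreal A"
    and hA: "\<And>n. (\<integral>\<^sup>+y. ennreal (h n y powr \<tau>) \<partial>lebesgue) \<le> ennreal A"
    and ae: "AE y in lebesgue. (\<lambda>n. h n y) \<longlonglongrightarrow> 0"
  shows "(\<lambda>n. riesz_form lam f (h n)) \<longlonglongrightarrow> 0"
proof (rule ennreal_tendsto_0I)
  fix e :: real assume e: "0 < e"
  have lam: "real DIM('a) * (1 - 1 / \<tau>) < lam"
    by (rule conjugate_exponent_bound[OF _ exps(1,4)]) simp
  obtain C1 where C1: "0 \<le> C1" "\<And>(h :: 'a::euclidean_space \<Rightarrow> real) A x t a.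
    h \<in> borel_measurable lebesgue \<Longrightarrow> (\<And>y. 0 \<le> h y) \<Longrightarrow>
    (\<integral>\<^sup>+y. ennreal (h y powr \<tau>) \<partial>lebesgue) \<le> ennreal A \<Longrightarrow> 0 \<le> A \<Longrightarrow> 0 \<le> t \<Longrightarrow> 0 \<le> a \<Longrightarrow>
    (\<integral>\<^sup>+y. ennreal (norm (x - y) powr - lam * h y * a) * indicator {y. h y \<le> t * a powr (\<theta> / \<tau>)} y \<partial>lebesgue)
      \<le> ennreal (C1 * (1 + A) * t powr (\<tau> - \<tau> / \<theta>) * a powr \<theta>)"
    using capped_fibre[where 'a='a, OF exps] by blast
  obtain C2 where C2: "0 \<le> C2" "\<And>(f :: 'a::euclidean_space \<Rightarrow> real) h A t.
    f \<in> borel_measurable lebesgue \<Longrightarrow> (\<And>y. 0 \<le> f y) \<Longrightarrow>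
    h \<in> borel_measurable lebesgue \<Longrightarrow> (\<And>y. 0 \<le> h y) \<Longrightarrow>
    (\<integral>\<^sup>+y. ennreal (f y powr \<theta>) \<partial>lebesgue) \<le> ennreal A \<Longrightarrow>
    (\<integral>\<^sup>+y. ennreal (h y powr \<tau>) \<partial>lebesgue) \<le> ennreal A \<Longrightarrow> 0 \<le> A \<Longrightarrow> 0 < t \<Longrightarrow>
    riesz_form lam f h \<le>
      (\<integral>\<^sup>+y. \<integral>\<^sup>+x. ennreal (norm (y - x) powr - lam * h x * f y)
          * indicator {x. h x \<le> t * f y powr (\<theta> / \<tau>)} x \<partial>lebesgue \<partial>lebesgue)
      + ennreal (C2 * (1 + A) * A * t powr (1 - \<tau>))"
    using riesz_form_split[where 'a='a, OF exps] by blast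
  define D where "D = C2 * (1 + A) * A"
  have D: "0 \<le> D" using C2(1) A by (simp add: D_def)
  obtain t where t: "0 < t" "D * t powr (1 - \<tau>) \<le> e"
  proof
    define t where "t = (e / (D + 1)) powr (1 / (1 - \<tau>))"
    have p: "0 < e / (D + 1)" using e D by simp
    then show "0 < t" using e D by (simp add: t_def)
    have "t powr (1 - \<tau>) = e / (D + 1)" using e D exps by (simp add: t_def powr_powr)
    then have "D * t powr (1 - \<tau>) = e - t powr (1 - \<tau>)" using e D by (simp add: field_simps)
    then show "D * t powr (1 - \<tau>) \<le> e" by simp
  qed
  define \<psi> where "\<psi> n y = (\<integral>\<^sup>+x. ennreal (norm (y - x) powr - lam * h n x * f y)
          * indicator {x. h n x \<le> t * f y powr (\<theta> / \<tau>)} x \<partial>lebesgue)" for n y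
  have meas: "\<psi> n \<in> borel_measurable lebesgue" for n
  proof -
    let ?g = "\<lambda>z. ennreal (norm (fst z - snd z) powr - lam * h n (snd z) * f (fst z))
          * indicator {z. h n (snd z) \<le> t * f (fst z) powr (\<theta> / \<tau>)} z"
    have "{z \<in> space (lebesgue \<Otimes>\<^sub>M lebesgue). h n (snd z) \<le> t * f (fst z) powr (\<theta> / \<tau>)} \<in> sets (lebesgue \<Otimes>\<^sub>M lebesgue)"
      by measurable
    then have "?g \<in> borel_measurable (lebesgue \<Otimes>\<^sub>M lebesgue)"
      by (intro borel_measurable_times_ennreal borel_measurable_indicator) (auto simp: space_pair_measure)
    from lebesgue.borel_measurable_nn_integral_fst[OF this]
    show ?thesis by (simp add: \<psi>_def[abs_def] indicator_def)
  qed
  have "(\<lambda>n. \<integral>\<^sup>+y. \<psi> n y \<partial>lebesgue) \<longlonglongrightarrow> (\<integral>\<^sup>+y. 0 \<partial>(lebesgue :: 'a measure))"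
  proof (rule nn_integral_dominated_convergence)
    let ?w = "\<lambda>y. ennreal (C1 * (1 + A) * t powr (\<tau> - \<tau> / \<theta>) * f y powr \<theta>)"
    show "AE y in lebesgue. \<psi> j y \<le> ?w y" for j
      unfolding \<psi>_def using t by (intro AE_I2 C1(2) h h0 hA A f0) simp
    have "(\<integral>\<^sup>+y. ?w y \<partial>lebesgue)
        = ennreal (C1 * (1 + A) * t powr (\<tau> - \<tau> / \<theta>)) * (\<integral>\<^sup>+y. ennreal (f y powr \<theta>) \<partial>lebesgue)"
      using C1(1) A by (subst nn_integral_cmult[symmetric]) (auto simp: ennreal_mult)
    also have "\<dots> \<le> ennreal (C1 * (1 + A) * t powr (\<tau> - \<tau> / \<theta>)) * ennreal A"
      by (intro mult_left_mono fA) simp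
    also have "\<dots> < \<infinity>" by (simp add: ennreal_mult_less_top)
    finally show "(\<integral>\<^sup>+y. ?w y \<partial>lebesgue) < \<infinity>" .
    have "(\<lambda>n. \<psi> n y) \<longlonglongrightarrow> 0" for y
    proof -
      let ?s = "t * f y powr (\<theta> / \<tau>)"
      have "\<psi> n y = ennreal (f y) * (\<integral>\<^sup>+x. ennreal (norm (y - x) powr - lam * h n x) * indicator {x. h n x \<le> ?s} x \<partial>lebesgue)" for n
        unfolding \<psi>_def using f0[of y] h0
        by (subst nn_integral_cmult[symmetric])
          (auto simp: indicator_def ennreal_mult[symmetric] mult_ac intro!: nn_integral_cong)
      moreover have "(\<lambda>n. ennreal (f y) * (\<integral>\<^sup>+x. ennreal (norm (y - x) powr - lam * h n x) * indicator {x. h n x \<le> ?s} x \<partial>lebesgue))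
          \<longlonglongrightarrow> ennreal (f y) * 0"
        using t by (intro ennreal_tendsto_cmult capped_potential_tendsto_0[OF exps(2) lam exps(3) h h0 hA A ae]) auto
      ultimately show ?thesis by simp
    qed
    then show "AE y in lebesgue. (\<lambda>n. \<psi> n y) \<longlonglongrightarrow> 0" by simp
  qed (use meas in auto)
  then have "(\<lambda>n. \<integral>\<^sup>+y. \<psi> n y \<partial>lebesgue) \<longlonglongrightarrow> 0" by simp
  moreover have "riesz_form lam f (h n) \<le> (\<integral>\<^sup>+y. \<psi> n y \<partial>lebesgue) + ennreal e" for n
  proof -
    have "riesz_form lam f (h n) \<le> (\<integral>\<^sup>+y. \<psi> n y \<partial>lebesgue) + ennreal (D * t powr (1 - \<tau>))"
      unfolding \<psi>_def D_def by (intro C2(2) f f0 h h0 fA hA A t)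
    also have "\<dots> \<le> (\<integral>\<^sup>+y. \<psi> n y \<partial>lebesgue) + ennreal e" by (intro add_left_mono ennreal_leI t)
    finally show ?thesis .
  qed
  ultimately show "\<exists>b. (b \<longlonglongrightarrow> 0) \<and> (\<forall>n. riesz_form lam f (h n) \<le> b n + ennreal e)" by blast
qed

section \<open>Pointwise inequalities\<close>

text \<open>
  If \<open>\<bar>b\<bar> \<le> \<delta> \<bar>a\<bar>\<close> with \<open>\<delta>\<close> small, the quotient of \<open>\<bar>a + b\<bar>\<close> and \<open>\<bar>a\<bar>\<close> is close to 1, and the continuity of
  \<open>x\<^sup>p\<close> at 1 gives the first term; otherwise both powers are bounded by a multiple of \<open>\<bar>b\<bar>\<^sup>p\<close>.
\<close>

lemma abs_powr_perturb:
  fixes p \<epsilon> :: real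
  assumes p: "0 < p" and eps: "0 < \<epsilon>"
  obtains C where "0 \<le> C" "\<And>a b :: real. \<bar>\<bar>a + b\<bar> powr p - \<bar>a\<bar> powr p\<bar> \<le> \<epsilon> * \<bar>a\<bar> powr p + C * \<bar>b\<bar> powr p"
proof -
  have "((\<lambda>x::real. x powr p) \<longlongrightarrow> 1 powr p) (at 1)" by (intro tendsto_intros) auto
  then obtain d where d: "0 < d" "\<And>x::real. x \<noteq> 1 \<Longrightarrow> dist x 1 < d \<Longrightarrow> dist (x powr p) (1 powr p) < \<epsilon>"
    using eps unfolding tendsto_iff eventually_at by (metis UNIV_I)
  define \<delta> where "\<delta> = min d 1 / 2"
  have del: "0 < \<delta>" "\<delta> < d" "\<delta> < 1" using d by (auto simp: \<delta>_def min_def)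
  have up: "(1 + \<delta>) powr p \<le> 1 + \<epsilon>" using d(2)[of "1 + \<delta>"] del by (auto simp: dist_real_def)
  have lo: "1 - \<epsilon> \<le> (1 - \<delta>) powr p" using d(2)[of "1 - \<delta>"] del by (auto simp: dist_real_def)
  define C where "C = (1 / \<delta> + 1) powr p"
  have "\<bar>\<bar>a + b\<bar> powr p - \<bar>a\<bar> powr p\<bar> \<le> \<epsilon> * \<bar>a\<bar> powr p + C * \<bar>b\<bar> powr p" for a b :: real
  proof (cases "\<bar>b\<bar> \<le> \<delta> * \<bar>a\<bar>")
    case True
    have da: "\<delta> * \<bar>a\<bar> \<le> \<bar>a\<bar>" using del by (simp add: mult_left_le_one_le)
    have "\<bar>a + b\<bar> powr p \<le> ((1 + \<delta>) * \<bar>a\<bar>) powr p"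
      using True p by (intro powr_mono2) (auto simp: algebra_simps)
    also have "\<dots> \<le> (1 + \<epsilon>) * \<bar>a\<bar> powr p"
      using up del by (simp add: powr_mult mult_right_mono)
    finally have 1: "\<bar>a + b\<bar> powr p \<le> (1 + \<epsilon>) * \<bar>a\<bar> powr p" .
    have "(1 - \<epsilon>) * \<bar>a\<bar> powr p \<le> ((1 - \<delta>) * \<bar>a\<bar>) powr p"
      using lo del by (simp add: powr_mult mult_right_mono)
    also have "\<dots> \<le> \<bar>a + b\<bar> powr p"
      using True p da by (intro powr_mono2) (auto simp: left_diff_distrib)
    finally have 2: "(1 - \<epsilon>) * \<bar>a\<bar> powr p \<le> \<bar>a + b\<bar> powr p" .
    have "\<bar>\<bar>a + b\<bar> powr p - \<bar>a\<bar> powr p\<bar> \<le> \<epsilon> * \<bar>a\<bar> powr p"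
      using 1 2 by (simp add: abs_le_iff algebra_simps)
    moreover have "0 \<le> C * \<bar>b\<bar> powr p" by (simp add: C_def)
    ultimately show ?thesis by linarith
  next
    case False
    then have a: "\<bar>a\<bar> \<le> 1 / \<delta> * \<bar>b\<bar>" using del by (simp add: field_simps)
    have "\<bar>a + b\<bar> powr p \<le> ((1 / \<delta> + 1) * \<bar>b\<bar>) powr p"
      using a p by (intro powr_mono2) (auto simp: algebra_simps)
    then have 1: "\<bar>a + b\<bar> powr p \<le> C * \<bar>b\<bar> powr p" using del by (simp add: C_def powr_mult)
    have "\<bar>a\<bar> powr p \<le> ((1 / \<delta> + 1) * \<bar>b\<bar>) powr p"
      using a p by (intro powr_mono2) (auto simp: algebra_simps)
    then have 2: "\<bar>a\<bar> powr p \<le> C * \<bar>b\<bar> powr p" using del by (simp add: C_def powr_mult)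
    have "0 \<le> \<epsilon> * \<bar>a\<bar> powr p" "0 \<le> \<bar>a + b\<bar> powr p" "0 \<le> \<bar>a\<bar> powr p" using eps by auto
    with 1 2 show ?thesis by linarith
  qed
  then show thesis using that[of C] by (simp add: C_def)
qed

text \<open>
  Expand \<open>f h - g k = (f - g)(h - k) + (f - g) k + g (h - k)\<close>. The integral of
  \<open>g k\<close> is merely bounded in the application, so this product must come with the factor \<open>\<epsilon>\<close>; the mixed
  terms may have a large coefficient, because their integrals tend to zero.
\<close>

lemma product_perturb:
  fixes f g F h k H \<epsilon> C :: real
  assumes nn: "0 \<le> g" "0 \<le> F" "0 \<le> k" "0 \<le> H" "0 \<le> C" "0 \<le> \<epsilon>" "\<epsilon> \<le> 1"
    and fg: "\<bar>f - g\<bar> \<le> \<epsilon> * g + C * F" and hk: "\<bar>h - k\<bar> \<le> \<epsilon> * k + C * H"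
  shows "\<bar>f * h - g * k - F * H\<bar> \<le> 3 * \<epsilon> * (g * k) + 2 * C * (g * H + F * k) + (C\<^sup>2 + 1) * (F * H)"
proof -
  have "f * h - g * k = (f - g) * (h - k) + (f - g) * k + g * (h - k)" by (simp add: algebra_simps)
  then have "\<bar>f * h - g * k - F * H\<bar> \<le> \<bar>f - g\<bar> * \<bar>h - k\<bar> + \<bar>f - g\<bar> * k + g * \<bar>h - k\<bar> + F * H"
    using abs_mult[of "f - g" "h - k"] abs_mult[of "f - g" k] abs_mult[of g "h - k"]
      mult_nonneg_nonneg[OF nn(2,4)] nn(1,3) by linarith
  also have "\<dots> \<le> (\<epsilon> * g + C * F) * (\<epsilon> * k + C * H) + (\<epsilon> * g + C * F) * k + g * (\<epsilon> * k + C * H) + F * H"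
    using fg hk nn by (intro add_mono mult_mono order_refl) auto
  also have "\<dots> = \<epsilon> * \<epsilon> * (g * k) + \<epsilon> * (C * (g * H + F * k)) + 2 * \<epsilon> * (g * k) + C * (g * H + F * k) + (C\<^sup>2 + 1) * (F * H)"
    by (simp add: algebra_simps power2_eq_square)
  also have "\<dots> \<le> \<epsilon> * (g * k) + 1 * (C * (g * H + F * k)) + 2 * \<epsilon> * (g * k) + C * (g * H + F * k) + (C\<^sup>2 + 1) * (F * H)"
    using nn by (intro add_mono mult_right_mono order_refl) (auto simp: mult_left_le)
  also have "\<dots> = 3 * \<epsilon> * (g * k) + 2 * C * (g * H + F * k) + (C\<^sup>2 + 1) * (F * H)"
    by (simp add: algebra_simps)
  finally show ?thesis .
qed

section \<open>Almost everywhere limits\<close>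

lemma AE_lebesgue_fst:
  assumes "AE x in (lebesgue :: 'a::euclidean_space measure). P x"
  shows "AE z in lebesgue \<Otimes>\<^sub>M (lebesgue :: 'b::euclidean_space measure). P (fst z)"
proof -
  obtain N where N: "N \<in> null_sets lebesgue" "\<forall>x. x \<notin> N \<longrightarrow> P x"
    using AE_E3[OF assms] by auto
  have "N \<times> UNIV \<in> null_sets (lebesgue \<Otimes>\<^sub>M (lebesgue :: 'b measure))"
    using N(1) lebesgue.emeasure_pair_measure_Times[of N lebesgue "UNIV :: 'b set"]
    by (auto simp: null_sets_def)
  then show ?thesis by (rule AE_I') (use N(2) in auto)
qed

lemma AE_lebesgue_snd:
  assumes "AE x in (lebesgue :: 'a::euclidean_space measure). P x"
  shows "AE z in (lebesgue :: 'b::euclidean_space measure) \<Otimes>\<^sub>M lebesgue. P (snd z)"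
proof -
  obtain N where N: "N \<in> null_sets lebesgue" "\<forall>x. x \<notin> N \<longrightarrow> P x"
    using AE_E3[OF assms] by auto
  have "UNIV \<times> N \<in> null_sets ((lebesgue :: 'b measure) \<Otimes>\<^sub>M lebesgue)"
    using N(1) lebesgue.emeasure_pair_measure_Times[of "UNIV :: 'b set" lebesgue N]
    by (auto simp: null_sets_def)
  then show ?thesis by (rule AE_I') (use N(2) in auto)
qed

lemma borel_measurable_lebesgue_AE_LIMSEQ:
  fixes u :: "'a::euclidean_space \<Rightarrow> real"
  assumes us [measurable]: "\<And>n. us n \<in> borel_measurable lebesgue"
    and ae: "AE x in lebesgue. (\<lambda>n. us n x) \<longlonglongrightarrow> u x"
  shows "u \<in> borel_measurable lebesgue"
proof -
  obtain N where N: "N \<in> null_sets lebesgue" "\<And>x. x \<notin> N \<Longrightarrow> (\<lambda>n. us n x) \<longlonglongrightarrow> u x"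
    using AE_E3[OF ae] by auto
  have [measurable]: "N \<in> sets lebesgue" using N by auto
  have "(\<lambda>x. if x \<in> N then 0 else u x) \<in> borel_measurable lebesgue"
  proof (rule borel_measurable_LIMSEQ_real)
    show "(\<lambda>n. if x \<in> N then 0 else us n x) \<longlonglongrightarrow> (if x \<in> N then 0 else u x)" for x
      using N(2) by auto
  qed measurable
  moreover have "AE x in lebesgue. (if x \<in> N then 0 else u x) = u x"
    using AE_not_in[OF N(1)] by eventually_elim auto
  ultimately show ?thesis by (rule borel_measurable_AE)
qed

text \<open>
  Fatou's lemma puts the limit in \<open>L\<^sup>s\<close>; the differences are then bounded there too. Bounds on the
  integrals of \<open>s\<close>-th powers, with one constant for all functions involved, are what
  \<open>hardy_littlewood_sobolev\<close> and \<open>riesz_form_tendsto_0\<close> take as input.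
\<close>

lemma Lp_bounded_AE_limit:
  fixes u :: "'a::euclidean_space \<Rightarrow> real"
  assumes s: "0 < s" and us: "\<And>n. us n \<in> Lp_space s" and bd: "bounded (range (\<lambda>n. Lp_norm s (us n)))"
    and ae: "AE x in lebesgue. (\<lambda>n. us n x) \<longlonglongrightarrow> u x"
  obtains A where "0 \<le> A" "(\<integral>\<^sup>+x. ennreal (\<bar>u x\<bar> powr s) \<partial>lebesgue) \<le> ennreal A"
    "\<And>n. (\<integral>\<^sup>+x. ennreal (\<bar>us n x\<bar> powr s) \<partial>lebesgue) \<le> ennreal A"
    "\<And>n. (\<integral>\<^sup>+x. ennreal (\<bar>us n x - u x\<bar> powr s) \<partial>lebesgue) \<le> ennreal A"
proof -
  have m [measurable]: "us n \<in> borel_measurable lebesgue" for n using us by (auto simp: Lp_space_def)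
  have um [measurable]: "u \<in> borel_measurable lebesgue"
    by (rule borel_measurable_lebesgue_AE_LIMSEQ[OF m ae])
  obtain B where B: "\<And>n. \<bar>Lp_norm s (us n)\<bar> \<le> B" using bd by (auto simp: bounded_iff)
  define A where "A = B powr s"
  have usA: "(\<integral>\<^sup>+x. ennreal (\<bar>us n x\<bar> powr s) \<partial>lebesgue) \<le> ennreal A" for n
  proof -
    have i: "integrable lebesgue (\<lambda>x. \<bar>us n x\<bar> powr s)" using us by (auto simp: Lp_space_def)
    let ?I = "\<integral>x. \<bar>us n x\<bar> powr s \<partial>lebesgue"
    have I0: "0 \<le> ?I" by simp
    have "?I powr (1 / s) \<le> B" using B[of n] by (auto simp: Lp_norm_def)
    then have "(?I powr (1 / s)) powr s \<le> A" unfolding A_def using s by (intro powr_mono2) auto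
    then have "?I \<le> A" using s I0 by (simp add: powr_powr)
    then show ?thesis using i by (subst nn_integral_eq_integral) (auto intro: ennreal_leI)
  qed
  have uA: "(\<integral>\<^sup>+x. ennreal (\<bar>u x\<bar> powr s) \<partial>lebesgue) \<le> ennreal A"
  proof -
    have "AE x in lebesgue. ennreal (\<bar>u x\<bar> powr s) = liminf (\<lambda>n. ennreal (\<bar>us n x\<bar> powr s))"
      using ae
    proof eventually_elim
      case (elim x)
      have "(\<lambda>n. ennreal (\<bar>us n x\<bar> powr s)) \<longlonglongrightarrow> ennreal (\<bar>u x\<bar> powr s)"
        using s by (intro tendsto_ennrealI tendsto_powr' tendsto_rabs elim tendsto_const) auto
      from lim_imp_Liminf[OF trivial_limit_sequentially this] show ?case by (rule sym)
    qed
    then have "(\<integral>\<^sup>+x. ennreal (\<bar>u x\<bar> powr s) \<partial>lebesgue)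
        = (\<integral>\<^sup>+x. liminf (\<lambda>n. ennreal (\<bar>us n x\<bar> powr s)) \<partial>lebesgue)"
      by (rule nn_integral_cong_AE)
    also have "\<dots> \<le> liminf (\<lambda>n. \<integral>\<^sup>+x. ennreal (\<bar>us n x\<bar> powr s) \<partial>lebesgue)"
      by (rule nn_integral_liminf) measurable
    also have "\<dots> \<le> limsup (\<lambda>n. \<integral>\<^sup>+x. ennreal (\<bar>us n x\<bar> powr s) \<partial>lebesgue)"
      by (rule Liminf_le_Limsup) simp
    also have "\<dots> \<le> ennreal A" by (rule Limsup_bounded) (simp add: usA)
    finally show ?thesis .
  qed
  have pw: "\<bar>a - b\<bar> powr s \<le> 2 powr s * (\<bar>a\<bar> powr s + \<bar>b\<bar> powr s)" for a b :: real
  proof -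
    have "\<bar>a - b\<bar> powr s \<le> (2 * max \<bar>a\<bar> \<bar>b\<bar>) powr s" using s by (intro powr_mono2) auto
    also have "\<dots> = 2 powr s * max \<bar>a\<bar> \<bar>b\<bar> powr s" by (simp add: powr_mult)
    also have "\<dots> \<le> 2 powr s * (\<bar>a\<bar> powr s + \<bar>b\<bar> powr s)"
      by (intro mult_left_mono) (auto simp: max_def)
    finally show ?thesis .
  qed
  have dA: "(\<integral>\<^sup>+x. ennreal (\<bar>us n x - u x\<bar> powr s) \<partial>lebesgue) \<le> ennreal (2 powr s * (A + A))" for n
  proof -
    have "(\<integral>\<^sup>+x. ennreal (\<bar>us n x - u x\<bar> powr s) \<partial>lebesgue)
        \<le> (\<integral>\<^sup>+x. ennreal (2 powr s) * (ennreal (\<bar>us n x\<bar> powr s) + ennreal (\<bar>u x\<bar> powr s)) \<partial>lebesgue)"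
      by (intro nn_integral_mono)
        (simp add: ennreal_mult[symmetric] ennreal_plus[symmetric] pw ennreal_leI del: ennreal_plus)
    also have "\<dots> = ennreal (2 powr s) * ((\<integral>\<^sup>+x. ennreal (\<bar>us n x\<bar> powr s) \<partial>lebesgue) + (\<integral>\<^sup>+x. ennreal (\<bar>u x\<bar> powr s) \<partial>lebesgue))"
      by (simp add: nn_integral_cmult nn_integral_add)
    also have "\<dots> \<le> ennreal (2 powr s) * (ennreal A + ennreal A)"
      by (intro mult_left_mono add_mono usA uA) simp
    also have "\<dots> = ennreal (2 powr s * (A + A))"
      by (simp add: A_def ennreal_mult[symmetric] ennreal_plus[symmetric] del: ennreal_plus)
    finally show ?thesis .
  qed
  have A0: "0 \<le> A" by (simp add: A_def)
  have le: "A \<le> 2 powr s * (A + A)"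
  proof -
    have "1 * A \<le> 2 powr s * (A + A)" using A0 s by (intro mult_mono) (auto intro: ge_one_powr_ge_zero)
    then show ?thesis by simp
  qed
  show thesis
    by (rule that[of "2 powr s * (A + A)"])
      (use A0 order_trans[OF uA ennreal_leI[OF le]] order_trans[OF usA ennreal_leI[OF le]] dA in auto)
qed

section \<open>The Brezis--Lieb splitting of the double integral\<close>

text \<open>
  The splitting holds even with absolute values inside the double integral. For given \<open>\<epsilon>\<close>, the positive part \<open>D\<^sub>n\<close>
  of what \<open>3\<epsilon> g\<^sub>n k\<^sub>n\<close> and the mixed terms leave over is dominated by a multiple of \<open>F H\<close> and tends to zero almost
  everywhere; the mixed terms vanish by \<open>riesz_form_tendsto_0\<close>; and \<open>B(g\<^sub>n, k\<^sub>n)\<close> is bounded by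
  \<open>hardy_littlewood_sobolev\<close>, so that its coefficient \<open>3\<epsilon>\<close> makes it small.
\<close>

lemma riesz_form_brezis_lieb:
  fixes u v :: "'a::euclidean_space \<Rightarrow> real" and us vs :: "nat \<Rightarrow> 'a \<Rightarrow> real"
  assumes exps: "1 < \<theta>" "1 < \<tau>" "lam < real DIM('a)" "1 / \<theta> + 1 / \<tau> + lam / real DIM('a) = 2"
    and A: "0 \<le> A" and p: "0 < p" and q: "0 < q"
    and m [measurable]: "\<And>n. us n \<in> borel_measurable lebesgue" "\<And>n. vs n \<in> borel_measurable lebesgue"
      "u \<in> borel_measurable lebesgue" "v \<in> borel_measurable lebesgue"
    and uA: "(\<integral>\<^sup>+x. ennreal (\<bar>u x\<bar> powr (\<theta> * p)) \<partial>lebesgue) \<le> ennreal A"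
    and duA: "\<And>n. (\<integral>\<^sup>+x. ennreal (\<bar>us n x - u x\<bar> powr (\<theta> * p)) \<partial>lebesgue) \<le> ennreal A"
    and vA: "(\<integral>\<^sup>+x. ennreal (\<bar>v x\<bar> powr (\<tau> * q)) \<partial>lebesgue) \<le> ennreal A"
    and dvA: "\<And>n. (\<integral>\<^sup>+x. ennreal (\<bar>vs n x - v x\<bar> powr (\<tau> * q)) \<partial>lebesgue) \<le> ennreal A"
    and aeu: "AE x in lebesgue. (\<lambda>n. us n x) \<longlonglongrightarrow> u x"
    and aev: "AE x in lebesgue. (\<lambda>n. vs n x) \<longlonglongrightarrow> v x"
  shows "(\<lambda>n. \<integral>\<^sup>+z. ennreal (norm (fst z - snd z) powr - lam *
      \<bar>\<bar>us n (snd z)\<bar> powr p * \<bar>vs n (fst z)\<bar> powr q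
        - \<bar>us n (snd z) - u (snd z)\<bar> powr p * \<bar>vs n (fst z) - v (fst z)\<bar> powr q
        - \<bar>u (snd z)\<bar> powr p * \<bar>v (fst z)\<bar> powr q\<bar>) \<partial>(lebesgue \<Otimes>\<^sub>M lebesgue)) \<longlonglongrightarrow> 0"
proof -
  define K where "K z = norm (fst z - snd z) powr - lam" for z :: "'a \<times> 'a"
  define F where "F y = \<bar>u y\<bar> powr p" for y
  define H where "H x = \<bar>v x\<bar> powr q" for x
  define g where "g n y = \<bar>us n y - u y\<bar> powr p" for n y
  define k where "k n x = \<bar>vs n x - v x\<bar> powr q" for n x
  define W where "W n z = \<bar>\<bar>us n (snd z)\<bar> powr p * \<bar>vs n (fst z)\<bar> powr q
      - g n (snd z) * k n (fst z) - F (snd z) * H (fst z)\<bar>" for n and z :: "'a \<times> 'a"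
  have K [measurable]: "K \<in> borel_measurable (lebesgue \<Otimes>\<^sub>M lebesgue)" unfolding K_def by measurable
  have meas [measurable]: "F \<in> borel_measurable lebesgue" "H \<in> borel_measurable lebesgue"
    "g n \<in> borel_measurable lebesgue" "k n \<in> borel_measurable lebesgue"
    "W n \<in> borel_measurable (lebesgue \<Otimes>\<^sub>M lebesgue)" for n
    unfolding F_def H_def g_def k_def W_def by measurable
  have nn: "0 \<le> K z" "0 \<le> F y" "0 \<le> H y" "0 \<le> g n y" "0 \<le> k n y" "0 \<le> W n z" for n y z
    by (auto simp: K_def F_def H_def g_def k_def W_def)
  have FA: "(\<integral>\<^sup>+x. ennreal (F x powr \<theta>) \<partial>lebesgue) \<le> ennreal A"
    and gA: "(\<integral>\<^sup>+x. ennreal (g n x powr \<theta>) \<partial>lebesgue) \<le> ennreal A"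
    and HA: "(\<integral>\<^sup>+x. ennreal (H x powr \<tau>) \<partial>lebesgue) \<le> ennreal A"
    and kA: "(\<integral>\<^sup>+x. ennreal (k n x powr \<tau>) \<partial>lebesgue) \<le> ennreal A" for n
    using uA duA[of n] vA dvA[of n] by (simp_all add: F_def g_def H_def k_def powr_powr mult.commute)
  have gae: "AE y in lebesgue. (\<lambda>n. g n y) \<longlonglongrightarrow> 0"
    using aeu
  proof eventually_elim
    case (elim y)
    have "(\<lambda>n. \<bar>us n y - u y\<bar> powr p) \<longlonglongrightarrow> \<bar>u y - u y\<bar> powr p"
      using p by (intro tendsto_powr' tendsto_rabs tendsto_diff elim tendsto_const) auto
    then show ?case by (simp add: g_def)
  qed
  have kae: "AE x in lebesgue. (\<lambda>n. k n x) \<longlonglongrightarrow> 0"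
    using aev
  proof eventually_elim
    case (elim y)
    have "(\<lambda>n. \<bar>vs n y - v y\<bar> powr q) \<longlonglongrightarrow> \<bar>v y - v y\<bar> powr q"
      using q by (intro tendsto_powr' tendsto_rabs tendsto_diff elim tendsto_const) auto
    then show ?case by (simp add: k_def)
  qed
  have exps': "1 / \<tau> + 1 / \<theta> + lam / real DIM('a) = 2" using exps(4) by simp
  have Fk: "(\<lambda>n. riesz_form lam F (k n)) \<longlonglongrightarrow> 0"
    by (rule riesz_form_tendsto_0[OF exps A]) (use meas nn FA kA kae in auto)
  have "(\<lambda>n. riesz_form lam H (g n)) \<longlonglongrightarrow> 0"
    by (rule riesz_form_tendsto_0[OF exps(2,1,3) exps' A]) (use meas nn HA gA gae in auto)
  then have gH: "(\<lambda>n. riesz_form lam (g n) H) \<longlonglongrightarrow> 0"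
    by (simp add: riesz_form_commute[of H])
  obtain M where M: "0 \<le> M" "\<And>(f :: 'a \<Rightarrow> real) h.
    f \<in> borel_measurable lebesgue \<Longrightarrow> (\<And>y. 0 \<le> f y) \<Longrightarrow>
    h \<in> borel_measurable lebesgue \<Longrightarrow> (\<And>y. 0 \<le> h y) \<Longrightarrow>
    (\<integral>\<^sup>+y. ennreal (f y powr \<theta>) \<partial>lebesgue) \<le> ennreal A \<Longrightarrow>
    (\<integral>\<^sup>+y. ennreal (h y powr \<tau>) \<partial>lebesgue) \<le> ennreal A \<Longrightarrow>
    riesz_form lam f h \<le> ennreal M"
    using hardy_littlewood_sobolev[where 'a='a, OF exps A] by blast
  have "(\<lambda>n. \<integral>\<^sup>+z. ennreal (K z * W n z) \<partial>(lebesgue \<Otimes>\<^sub>M lebesgue)) \<longlonglongrightarrow> 0"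
  proof (rule ennreal_tendsto_0I)
    fix e :: real assume e: "0 < e"
    \<comment> \<open>then \<open>3\<epsilon> B(g\<^sub>n, k\<^sub>n) \<le> e\<close>; the minimum with 1 is for \<open>product_perturb\<close>\<close>
    define \<epsilon> where "\<epsilon> = min 1 (e / (3 * (M + 1)))"
    have eps: "0 < \<epsilon>" "\<epsilon> \<le> 1" using e M(1) by (auto simp: \<epsilon>_def)
    have "\<epsilon> \<le> e / (3 * (M + 1))" by (simp add: \<epsilon>_def)
    then have "\<epsilon> * (3 * (M + 1)) \<le> e" using M(1) by (simp add: pos_le_divide_eq)
    then have epsM: "3 * \<epsilon> * M \<le> e" using eps by (simp add: algebra_simps)
    obtain Cp where Cp: "0 \<le> Cp" "\<And>a b :: real. \<bar>\<bar>a + b\<bar> powr p - \<bar>a\<bar> powr p\<bar> \<le> \<epsilon> * \<bar>a\<bar> powr p + Cp * \<bar>b\<bar> powr p"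
      using abs_powr_perturb[OF p eps(1)] by blast
    obtain Cq where Cq: "0 \<le> Cq" "\<And>a b :: real. \<bar>\<bar>a + b\<bar> powr q - \<bar>a\<bar> powr q\<bar> \<le> \<epsilon> * \<bar>a\<bar> powr q + Cq * \<bar>b\<bar> powr q"
      using abs_powr_perturb[OF q eps(1)] by blast
    define C where "C = Cp + Cq"
    have C: "0 \<le> C" using Cp Cq by (simp add: C_def)
    have pw: "W n z \<le> 3 * \<epsilon> * (g n (snd z) * k n (fst z))
        + 2 * C * (g n (snd z) * H (fst z) + F (snd z) * k n (fst z)) + (C\<^sup>2 + 1) * (F (snd z) * H (fst z))" for n z
      unfolding W_def
    proof (rule product_perturb)
      have "\<bar>\<bar>us n (snd z)\<bar> powr p - g n (snd z)\<bar> \<le> \<epsilon> * g n (snd z) + Cp * F (snd z)"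
        using Cp(2)[of "us n (snd z) - u (snd z)" "u (snd z)"] by (simp add: g_def F_def)
      also have "\<dots> \<le> \<epsilon> * g n (snd z) + C * F (snd z)"
        using Cq(1) nn(2) by (intro add_left_mono mult_right_mono) (auto simp: C_def)
      finally show "\<bar>\<bar>us n (snd z)\<bar> powr p - g n (snd z)\<bar> \<le> \<epsilon> * g n (snd z) + C * F (snd z)" .
      have "\<bar>\<bar>vs n (fst z)\<bar> powr q - k n (fst z)\<bar> \<le> \<epsilon> * k n (fst z) + Cq * H (fst z)"
        using Cq(2)[of "vs n (fst z) - v (fst z)" "v (fst z)"] by (simp add: k_def H_def)
      also have "\<dots> \<le> \<epsilon> * k n (fst z) + C * H (fst z)"
        using Cp(1) nn(3) by (intro add_left_mono mult_right_mono) (auto simp: C_def)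
      finally show "\<bar>\<bar>vs n (fst z)\<bar> powr q - k n (fst z)\<bar> \<le> \<epsilon> * k n (fst z) + C * H (fst z)" .
    qed (use nn C eps in auto)
    define D where "D n z = max 0 (W n z - (3 * \<epsilon> * (g n (snd z) * k n (fst z))
        + 2 * C * (g n (snd z) * H (fst z) + F (snd z) * k n (fst z))))" for n z
    have D [measurable]: "D n \<in> borel_measurable (lebesgue \<Otimes>\<^sub>M lebesgue)" for n
      unfolding D_def by measurable
    have D0: "0 \<le> D n z" for n z by (simp add: D_def)
    have Dle: "D n z \<le> (C\<^sup>2 + 1) * (F (snd z) * H (fst z))" for n z
      using pw[of n z] nn by (auto simp: D_def)
    have Wle: "W n z \<le> D n z + 3 * \<epsilon> * (g n (snd z) * k n (fst z))
        + 2 * C * (g n (snd z) * H (fst z)) + 2 * C * (F (snd z) * k n (fst z))" for n z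
      by (simp add: D_def max_def algebra_simps)
    have "(\<lambda>n. \<integral>\<^sup>+z. ennreal (K z * D n z) \<partial>(lebesgue \<Otimes>\<^sub>M lebesgue))
        \<longlonglongrightarrow> (\<integral>\<^sup>+z. 0 \<partial>((lebesgue :: 'a measure) \<Otimes>\<^sub>M (lebesgue :: 'a measure)))"
    proof (rule nn_integral_dominated_convergence)
      let ?w = "\<lambda>z. ennreal (C\<^sup>2 + 1) * ennreal (K z * F (snd z) * H (fst z))"
      show "?w \<in> borel_measurable (lebesgue \<Otimes>\<^sub>M lebesgue)" by measurable
      have "K z * D n z \<le> (C\<^sup>2 + 1) * (K z * F (snd z) * H (fst z))" for n z
        using mult_left_mono[OF Dle[of n z] nn(1)[of z]] by (simp add: mult_ac)
      then have "ennreal (K z * D n z) \<le> ennreal ((C\<^sup>2 + 1) * (K z * F (snd z) * H (fst z)))" for n z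
        by (rule ennreal_leI)
      also have "ennreal ((C\<^sup>2 + 1) * (K z * F (snd z) * H (fst z))) = ?w z" for z
        by (rule ennreal_mult) (use nn in auto)
      finally show "AE z in lebesgue \<Otimes>\<^sub>M lebesgue. ennreal (K z * D j z) \<le> ?w z" for j
        by (intro AE_I2)
      have "(\<integral>\<^sup>+z. ?w z \<partial>(lebesgue \<Otimes>\<^sub>M lebesgue)) = ennreal (C\<^sup>2 + 1) * riesz_form lam F H"
        unfolding riesz_form_def K_def[symmetric] by (rule nn_integral_cmult) measurable
      also have "\<dots> \<le> ennreal (C\<^sup>2 + 1) * ennreal M"
        by (intro mult_left_mono M(2) meas nn FA HA) simp
      also have "\<dots> < \<infinity>" by (simp add: ennreal_mult_less_top)
      finally show "(\<integral>\<^sup>+z. ?w z \<partial>(lebesgue \<Otimes>\<^sub>M lebesgue)) < \<infinity>" .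
      show "AE z in lebesgue \<Otimes>\<^sub>M lebesgue. (\<lambda>n. ennreal (K z * D n z)) \<longlonglongrightarrow> 0"
        using AE_lebesgue_snd[OF aeu, where 'b='a] AE_lebesgue_fst[OF aev, where 'b='a]
          AE_lebesgue_snd[OF gae, where 'b='a] AE_lebesgue_fst[OF kae, where 'b='a]
      proof eventually_elim
        case (elim z)
        have l: "(\<lambda>n. \<bar>us n (snd z)\<bar> powr p) \<longlonglongrightarrow> F (snd z)" "(\<lambda>n. \<bar>vs n (fst z)\<bar> powr q) \<longlonglongrightarrow> H (fst z)"
          unfolding F_def H_def using p q
          by (intro tendsto_powr' tendsto_rabs elim tendsto_const; simp)+
        have "(\<lambda>n. K z * D n z) \<longlonglongrightarrow> K z * max 0 (\<bar>F (snd z) * H (fst z) - 0 * 0 - F (snd z) * H (fst z)\<bar>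
            - (3 * \<epsilon> * (0 * 0) + 2 * C * (0 * H (fst z) + F (snd z) * 0)))"
          unfolding D_def W_def by (intro tendsto_intros l elim)
        then have "(\<lambda>n. K z * D n z) \<longlonglongrightarrow> 0" by simp
        then show ?case by (metis ennreal_0 tendsto_ennrealI)
      qed
    qed measurable
    then have lim: "(\<lambda>n. (\<integral>\<^sup>+z. ennreal (K z * D n z) \<partial>(lebesgue \<Otimes>\<^sub>M lebesgue))
        + ennreal (2 * C) * riesz_form lam (g n) H + ennreal (2 * C) * riesz_form lam F (k n))
        \<longlonglongrightarrow> 0 + ennreal (2 * C) * 0 + ennreal (2 * C) * 0"
      by (intro tendsto_add ennreal_tendsto_cmult gH Fk) auto
    have "(\<integral>\<^sup>+z. ennreal (K z * W n z) \<partial>(lebesgue \<Otimes>\<^sub>M lebesgue))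
        \<le> (\<integral>\<^sup>+z. ennreal (K z * D n z) \<partial>(lebesgue \<Otimes>\<^sub>M lebesgue))
        + ennreal (2 * C) * riesz_form lam (g n) H + ennreal (2 * C) * riesz_form lam F (k n) + ennreal e" for n
    proof -
      have "(\<integral>\<^sup>+z. ennreal (K z * W n z) \<partial>(lebesgue \<Otimes>\<^sub>M lebesgue))
          \<le> (\<integral>\<^sup>+z. ennreal (K z * D n z) + ennreal (2 * C) * ennreal (K z * g n (snd z) * H (fst z))
              + ennreal (2 * C) * ennreal (K z * F (snd z) * k n (fst z))
              + ennreal (3 * \<epsilon>) * ennreal (K z * g n (snd z) * k n (fst z)) \<partial>(lebesgue \<Otimes>\<^sub>M lebesgue))"
      proof (rule nn_integral_mono)
        fix z
        have "K z * W n z \<le> K z * D n z + 2 * C * (K z * g n (snd z) * H (fst z))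
            + 2 * C * (K z * F (snd z) * k n (fst z)) + 3 * \<epsilon> * (K z * g n (snd z) * k n (fst z))"
          using mult_left_mono[OF Wle[of n z] nn(1)[of z]] by (simp add: algebra_simps)
        then show "ennreal (K z * W n z) \<le> ennreal (K z * D n z) + ennreal (2 * C) * ennreal (K z * g n (snd z) * H (fst z))
              + ennreal (2 * C) * ennreal (K z * F (snd z) * k n (fst z))
              + ennreal (3 * \<epsilon>) * ennreal (K z * g n (snd z) * k n (fst z))"
          using C eps(1) nn D0
          by (simp add: ennreal_mult[symmetric] ennreal_plus[symmetric] ennreal_leI del: ennreal_plus)
      qed
      also have "\<dots> = (\<integral>\<^sup>+z. ennreal (K z * D n z) \<partial>(lebesgue \<Otimes>\<^sub>M lebesgue))
          + ennreal (2 * C) * riesz_form lam (g n) H + ennreal (2 * C) * riesz_form lam F (k n)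
          + ennreal (3 * \<epsilon>) * riesz_form lam (g n) (k n)"
        unfolding riesz_form_def K_def[symmetric]
        by (simp add: nn_integral_add nn_integral_cmult)
      also have "ennreal (3 * \<epsilon>) * riesz_form lam (g n) (k n) \<le> ennreal (3 * \<epsilon>) * ennreal M"
        by (intro mult_left_mono M(2) meas nn gA kA) simp
      also have "ennreal (3 * \<epsilon>) * ennreal M \<le> ennreal e"
        using epsM eps(1) M(1) by (simp add: ennreal_mult[symmetric] ennreal_leI)
      finally show ?thesis by (simp add: add_left_mono)
    qed
    with lim show "\<exists>b. (b \<longlonglongrightarrow> 0) \<and> (\<forall>n. (\<integral>\<^sup>+z. ennreal (K z * W n z) \<partial>(lebesgue \<Otimes>\<^sub>M lebesgue)) \<le> b n + ennreal e)"
      by (intro exI conjI allI) auto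
  qed
  then show ?thesis by (simp add: K_def W_def F_def H_def g_def k_def)
qed

section \<open>From the double integral to convolutions\<close>

lemma riesz_form_integrable:
  fixes f g :: "'a::euclidean_space \<Rightarrow> real"
  assumes [measurable]: "f \<in> borel_measurable lebesgue" "g \<in> borel_measurable lebesgue"
    and f0: "\<And>y. 0 \<le> f y" and g0: "\<And>y. 0 \<le> g y" and fin: "riesz_form lam f g < \<infinity>"
  shows "integrable (lebesgue \<Otimes>\<^sub>M lebesgue) (\<lambda>z. norm (fst z - snd z) powr - lam * f (snd z) * g (fst z))"
  using fin f0 g0 unfolding riesz_form_def by (intro integrableI_nonneg) auto

text \<open>
  Fubini's theorem. At a point \<open>x\<close> where the convolution integral does not exist, \<open>convolve\<close> has the
  default value 0; the identity of the inner integrals persists there, because constant factors can be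
  moved across the Bochner integral even when it does not exist.
\<close>

lemma integral_convolve_riesz_potential:
  fixes f g :: "'a::euclidean_space \<Rightarrow> real"
  assumes i: "integrable (lebesgue \<Otimes>\<^sub>M lebesgue)
      (\<lambda>z. norm (fst z - snd z) powr - (real DIM('a) - \<alpha>) * f (snd z) * g (fst z))"
  shows "(\<integral>x. convolve (riesz_potential \<alpha>) f x * g x \<partial>lebesgue)
    = Gamma ((real DIM('a) - \<alpha>) / 2) / (Gamma (\<alpha> / 2) * pi powr (real DIM('a) / 2) * 2 powr \<alpha>)
      * (\<integral>z. norm (fst z - snd z) powr - (real DIM('a) - \<alpha>) * f (snd z) * g (fst z) \<partial>(lebesgue \<Otimes>\<^sub>M lebesgue))"
proof -
  let ?c = "Gamma ((real DIM('a) - \<alpha>) / 2) / (Gamma (\<alpha> / 2) * pi powr (real DIM('a) / 2) * 2 powr \<alpha>)"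
  have "convolve (riesz_potential \<alpha>) f x
      = ?c * (\<integral>y. norm (x - y) powr - (real DIM('a) - \<alpha>) * f y \<partial>lebesgue)" for x
    unfolding convolve_def riesz_potential_def by (simp only: mult.assoc integral_mult_right_zero)
  then have "convolve (riesz_potential \<alpha>) f x * g x
      = ?c * (\<integral>y. norm (x - y) powr - (real DIM('a) - \<alpha>) * f y * g x \<partial>lebesgue)" for x
    by (simp only: mult.assoc[of ?c] integral_mult_left_zero)
  then have "(\<integral>x. convolve (riesz_potential \<alpha>) f x * g x \<partial>lebesgue)
      = ?c * (\<integral>x. \<integral>y. norm (x - y) powr - (real DIM('a) - \<alpha>) * f y * g x \<partial>lebesgue \<partial>lebesgue)"
    by simp
  also have "(\<integral>x. \<integral>y. norm (x - y) powr - (real DIM('a) - \<alpha>) * f y * g x \<partial>lebesgue \<partial>lebesgue)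
      = (\<integral>z. norm (fst z - snd z) powr - (real DIM('a) - \<alpha>) * f (snd z) * g (fst z) \<partial>(lebesgue \<Otimes>\<^sub>M lebesgue))"
    using lebesgue_pair.integral_fst'[OF i] by simp
  finally show ?thesis .
qed

theorem proposition4p2:
  fixes u v :: "'a::euclidean_space \<Rightarrow> real"
    and us vs :: "nat \<Rightarrow> 'a \<Rightarrow> real"
    and \<alpha> p q \<theta>\<^sub>1 \<theta>\<^sub>2 :: real
  assumes "0 < \<alpha>" and "\<alpha> < real DIM('a)"
    and "p \<ge> 1" and "q \<ge> 1"
    and "\<theta>\<^sub>1 > 1" and "\<theta>\<^sub>2 > 1"
    and "1 / \<theta>\<^sub>1 + 1 / \<theta>\<^sub>2 = (real DIM('a) + \<alpha>) / real DIM('a)"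
    and "\<And>n. us n \<in> Lp_space (\<theta>\<^sub>1 * p)"
    and "bounded (range (\<lambda>n. Lp_norm (\<theta>\<^sub>1 * p) (us n)))"
    and "\<And>n. vs n \<in> Lp_space (\<theta>\<^sub>2 * q)"
    and "bounded (range (\<lambda>n. Lp_norm (\<theta>\<^sub>2 * q) (vs n)))"
    and "AE x in lebesgue. (\<lambda>n. us n x) \<longlonglongrightarrow> u x"
    and "AE x in lebesgue. (\<lambda>n. vs n x) \<longlonglongrightarrow> v x"
  shows "(\<lambda>n.
      (\<integral>x. convolve (riesz_potential \<alpha>) (\<lambda>y. \<bar>us n y\<bar> powr p) x
             * \<bar>vs n x\<bar> powr q \<partial>lebesgue)
      - (\<integral>x. convolve (riesz_potential \<alpha>) (\<lambda>y. \<bar>us n y - u y\<bar> powr p) x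
             * \<bar>vs n x - v x\<bar> powr q \<partial>lebesgue))
    \<longlonglongrightarrow> (\<integral>x. convolve (riesz_potential \<alpha>) (\<lambda>y. \<bar>u y\<bar> powr p) x
             * \<bar>v x\<bar> powr q \<partial>lebesgue)"
proof -
  define lam where "lam = real DIM('a) - \<alpha>"
  have lam: "lam < real DIM('a)" using assms(1) by (simp add: lam_def)
  have exps: "1 / \<theta>\<^sub>1 + 1 / \<theta>\<^sub>2 + lam / real DIM('a) = 2"
    unfolding assms(7) by (simp add: lam_def field_simps)
  have sp: "0 < \<theta>\<^sub>1 * p" "0 < \<theta>\<^sub>2 * q" using assms(3-6) by auto
  have pq: "0 < p" "0 < q" using assms(3,4) by auto
  have usm [measurable]: "us n \<in> borel_measurable lebesgue" and vsm [measurable]: "vs n \<in> borel_measurable lebesgue" for n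
    using assms(8,10) by (auto simp: Lp_space_def)
  have um [measurable]: "u \<in> borel_measurable lebesgue"
    by (rule borel_measurable_lebesgue_AE_LIMSEQ[OF usm assms(12)])
  have vm [measurable]: "v \<in> borel_measurable lebesgue"
    by (rule borel_measurable_lebesgue_AE_LIMSEQ[OF vsm assms(13)])
  obtain A1 where A1: "0 \<le> A1" "(\<integral>\<^sup>+x. ennreal (\<bar>u x\<bar> powr (\<theta>\<^sub>1 * p)) \<partial>lebesgue) \<le> ennreal A1"
    "\<And>n. (\<integral>\<^sup>+x. ennreal (\<bar>us n x\<bar> powr (\<theta>\<^sub>1 * p)) \<partial>lebesgue) \<le> ennreal A1"
    "\<And>n. (\<integral>\<^sup>+x. ennreal (\<bar>us n x - u x\<bar> powr (\<theta>\<^sub>1 * p)) \<partial>lebesgue) \<le> ennreal A1"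
    using Lp_bounded_AE_limit[OF sp(1) assms(8,9,12)] by blast
  obtain A2 where A2: "0 \<le> A2" "(\<integral>\<^sup>+x. ennreal (\<bar>v x\<bar> powr (\<theta>\<^sub>2 * q)) \<partial>lebesgue) \<le> ennreal A2"
    "\<And>n. (\<integral>\<^sup>+x. ennreal (\<bar>vs n x\<bar> powr (\<theta>\<^sub>2 * q)) \<partial>lebesgue) \<le> ennreal A2"
    "\<And>n. (\<integral>\<^sup>+x. ennreal (\<bar>vs n x - v x\<bar> powr (\<theta>\<^sub>2 * q)) \<partial>lebesgue) \<le> ennreal A2"
    using Lp_bounded_AE_limit[OF sp(2) assms(10,11,13)] by blast
  define A where "A = A1 + A2"
  have A: "0 \<le> A" "ennreal A1 \<le> ennreal A" "ennreal A2 \<le> ennreal A"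
    using A1(1) A2(1) by (auto simp: A_def intro!: ennreal_leI)
  note bounds = order_trans[OF A1(2) A(2)] order_trans[OF A1(3) A(2)] order_trans[OF A1(4) A(2)]
    order_trans[OF A2(2) A(3)] order_trans[OF A2(3) A(3)] order_trans[OF A2(4) A(3)]
  define G where "G f g z = norm (fst z - snd z) powr - lam * \<bar>f (snd z)\<bar> powr p * \<bar>g (fst z)\<bar> powr q"
    for f g and z :: "'a \<times> 'a"
  obtain M where M: "0 \<le> M" "\<And>(f :: 'a \<Rightarrow> real) h.
    f \<in> borel_measurable lebesgue \<Longrightarrow> (\<And>y. 0 \<le> f y) \<Longrightarrow>
    h \<in> borel_measurable lebesgue \<Longrightarrow> (\<And>y. 0 \<le> h y) \<Longrightarrow>
    (\<integral>\<^sup>+y. ennreal (f y powr \<theta>\<^sub>1) \<partial>lebesgue) \<le> ennreal A \<Longrightarrow>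
    (\<integral>\<^sup>+y. ennreal (h y powr \<theta>\<^sub>2) \<partial>lebesgue) \<le> ennreal A \<Longrightarrow>
    riesz_form lam f h \<le> ennreal M"
    using hardy_littlewood_sobolev[where 'a='a, OF assms(5,6) lam exps A(1)] by blast
  have int: "integrable (lebesgue \<Otimes>\<^sub>M lebesgue) (G f g)"
    if [measurable]: "f \<in> borel_measurable lebesgue" "g \<in> borel_measurable lebesgue"
      and "(\<integral>\<^sup>+x. ennreal (\<bar>f x\<bar> powr (\<theta>\<^sub>1 * p)) \<partial>lebesgue) \<le> ennreal A"
        "(\<integral>\<^sup>+x. ennreal (\<bar>g x\<bar> powr (\<theta>\<^sub>2 * q)) \<partial>lebesgue) \<le> ennreal A" for f g
  proof -
    have "riesz_form lam (\<lambda>y. \<bar>f y\<bar> powr p) (\<lambda>x. \<bar>g x\<bar> powr q) \<le> ennreal M"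
      by (rule M(2)) (use that in \<open>auto simp: powr_powr mult.commute\<close>)
    also have "\<dots> < \<infinity>" by simp
    finally show ?thesis unfolding G_def by (intro riesz_form_integrable) auto
  qed
  have int1: "integrable (lebesgue \<Otimes>\<^sub>M lebesgue) (G (us n) (vs n))" for n
    by (rule int[OF usm vsm bounds(2,5)])
  have int2: "integrable (lebesgue \<Otimes>\<^sub>M lebesgue) (G (\<lambda>y. us n y - u y) (\<lambda>x. vs n x - v x))" for n
    by (rule int[OF _ _ bounds(3,6)]) auto
  note int3 = int[OF um vm bounds(1,4)]
  let ?c = "Gamma ((real DIM('a) - \<alpha>) / 2) / (Gamma (\<alpha> / 2) * pi powr (real DIM('a) / 2) * 2 powr \<alpha>)"
  note conv = integral_convolve_riesz_potential[where \<alpha> = \<alpha> and 'a = 'a, folded lam_def]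
  define E where "E n z = G (us n) (vs n) z - G (\<lambda>y. us n y - u y) (\<lambda>x. vs n x - v x) z - G u v z" for n z
  have intE: "integrable (lebesgue \<Otimes>\<^sub>M lebesgue) (E n)" for n
    unfolding E_def by (intro Bochner_Integration.integrable_diff int1 int2 int3)
  have "(\<lambda>n. \<integral>\<^sup>+z. ennreal \<bar>E n z\<bar> \<partial>(lebesgue \<Otimes>\<^sub>M lebesgue)) \<longlonglongrightarrow> 0"
  proof -
    have "\<bar>E n z\<bar> = norm (fst z - snd z) powr - lam *
      \<bar>\<bar>us n (snd z)\<bar> powr p * \<bar>vs n (fst z)\<bar> powr q
        - \<bar>us n (snd z) - u (snd z)\<bar> powr p * \<bar>vs n (fst z) - v (fst z)\<bar> powr q
        - \<bar>u (snd z)\<bar> powr p * \<bar>v (fst z)\<bar> powr q\<bar>" for n z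
    proof -
      have "E n z = norm (fst z - snd z) powr - lam *
        (\<bar>us n (snd z)\<bar> powr p * \<bar>vs n (fst z)\<bar> powr q
        - \<bar>us n (snd z) - u (snd z)\<bar> powr p * \<bar>vs n (fst z) - v (fst z)\<bar> powr q
        - \<bar>u (snd z)\<bar> powr p * \<bar>v (fst z)\<bar> powr q)"
        by (simp add: E_def G_def algebra_simps)
      then show ?thesis by (simp add: abs_mult)
    qed
    then show ?thesis
      using riesz_form_brezis_lieb[OF assms(5,6) lam exps A(1) pq usm vsm um vm bounds(1,3,4,6) assms(12,13)]
      by simp
  qed
  then have "(\<lambda>n. ennreal (\<integral>z. \<bar>E n z\<bar> \<partial>(lebesgue \<Otimes>\<^sub>M lebesgue))) \<longlonglongrightarrow> ennreal 0"
    using intE by (simp add: nn_integral_eq_integral)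
  then have lim: "(\<lambda>n. \<integral>z. \<bar>E n z\<bar> \<partial>(lebesgue \<Otimes>\<^sub>M lebesgue)) \<longlonglongrightarrow> 0"
    by (subst (asm) tendsto_ennreal_iff) auto
  have limE: "(\<lambda>n. \<integral>z. E n z \<partial>(lebesgue \<Otimes>\<^sub>M lebesgue)) \<longlonglongrightarrow> 0"
    by (rule Lim_null_comparison[OF _ lim]) (auto intro!: always_eventually)
  have "(\<lambda>n. ?c * (\<integral>z. E n z \<partial>(lebesgue \<Otimes>\<^sub>M lebesgue)) + ?c * (\<integral>z. G u v z \<partial>(lebesgue \<Otimes>\<^sub>M lebesgue)))
      \<longlonglongrightarrow> ?c * 0 + ?c * (\<integral>z. G u v z \<partial>(lebesgue \<Otimes>\<^sub>M lebesgue))"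
    by (intro tendsto_intros limE)
  moreover have "?c * (\<integral>z. E n z \<partial>(lebesgue \<Otimes>\<^sub>M lebesgue)) + ?c * (\<integral>z. G u v z \<partial>(lebesgue \<Otimes>\<^sub>M lebesgue))
      = ?c * (\<integral>z. G (us n) (vs n) z \<partial>(lebesgue \<Otimes>\<^sub>M lebesgue))
        - ?c * (\<integral>z. G (\<lambda>y. us n y - u y) (\<lambda>x. vs n x - v x) z \<partial>(lebesgue \<Otimes>\<^sub>M lebesgue))" for n
  proof -
    have "(\<integral>z. E n z \<partial>(lebesgue \<Otimes>\<^sub>M lebesgue)) = (\<integral>z. G (us n) (vs n) z \<partial>(lebesgue \<Otimes>\<^sub>M lebesgue))
        - (\<integral>z. G (\<lambda>y. us n y - u y) (\<lambda>x. vs n x - v x) z \<partial>(lebesgue \<Otimes>\<^sub>M lebesgue))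
        - (\<integral>z. G u v z \<partial>(lebesgue \<Otimes>\<^sub>M lebesgue))"
      unfolding E_def by (simp add: int1 int2 int3)
    then show ?thesis by (simp add: right_diff_distrib)
  qed
  ultimately show ?thesis
    using conv[OF int1[unfolded G_def]] conv[OF int2[unfolded G_def]] conv[OF int3[unfolded G_def]]
    by (simp add: G_def lam_def)
qed

end
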